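(* $\mathsf{FO(LFP)}$ cannot define all problems that are in $\mathrm{PTIME}$ and closed under substructures: there is an isomorphism-closed class of finite structures over a finite vocabulary that is decidable in polynomial time and closed under substructures but is not the class of finite models of any $\mathsf{FO(LFP)}$ sentence.
   Context: A class of structures is closed under substructures if whenever $\mathbf A$ belongs to it, every substructure of $\mathbf A$ belongs to it. $\mathsf{FO(LFP)}$ is first-order logic extended with the least fixed-point operator. *)

theory Defs
  imports "HOL-Computational_Algebra.Polynomial"
begin

text \<open>A finite relational vocabulary is given by the list of the arities of its symbols; the
  symbols themselves are the indices \<open>0, \<dots>, length \<tau> - 1\<close>.\<close>

type_synonym vocabulary = "nat list"

record 'a struct =
  univ :: "'a set"
  rel :: "nat \<Rightarrow> 'a list set"

text \<open>Universes are non-empty. Indices outside the vocabulary carry the empty relation, so that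
  equality of records is equality of structures.\<close>

definition fin_structs :: "vocabulary \<Rightarrow> 'a struct set" where
  "fin_structs \<tau> = {A. finite (univ A) \<and> univ A \<noteq> {} \<and>
     (\<forall>i < length \<tau>. \<forall>as \<in> rel A i. length as = \<tau> ! i \<and> set as \<subseteq> univ A) \<and>
     (\<forall>i \<ge> length \<tau>. rel A i = {})}"

definition isomorphic :: "vocabulary \<Rightarrow> 'a struct \<Rightarrow> 'b struct \<Rightarrow> bool" where
  "isomorphic \<tau> A B \<longleftrightarrow> (\<exists>f. bij_betw f (univ A) (univ B) \<and>
     (\<forall>i < length \<tau>. \<forall>as. length as = \<tau> ! i \<and> set as \<subseteq> univ A \<longrightarrow>
        (as \<in> rel A i \<longleftrightarrow> map f as \<in> rel B i)))"

definition substructure :: "vocabulary \<Rightarrow> 'a struct \<Rightarrow> 'a struct \<Rightarrow> bool" where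
  "substructure \<tau> B A \<longleftrightarrow> univ B \<subseteq> univ A \<and>
     (\<forall>i < length \<tau>. rel B i = {as \<in> rel A i. set as \<subseteq> univ B})"

definition iso_closed :: "vocabulary \<Rightarrow> 'a struct set \<Rightarrow> bool" where
  "iso_closed \<tau> C \<longleftrightarrow>
     (\<forall>A \<in> C. \<forall>B \<in> fin_structs \<tau>. isomorphic \<tau> A B \<longrightarrow> B \<in> C)"

definition substructure_closed :: "vocabulary \<Rightarrow> 'a struct set \<Rightarrow> bool" where
  "substructure_closed \<tau> C \<longleftrightarrow>
     (\<forall>A \<in> C. \<forall>B \<in> fin_structs \<tau>. substructure \<tau> B A \<longrightarrow> B \<in> C)"

text \<open>First-order and second-order variables are named by natural numbers.
  \<open>Lfp X xs \<phi> ts\<close> stands for \<open>[lfp\<^bsub>X,xs\<^esub> \<phi>](ts)\<close>; it binds \<open>X\<close>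
  and \<open>xs\<close> in \<open>\<phi>\<close>, and \<open>\<phi>\<close> may have further free variables of both sorts. The remaining
  connectives and the universal quantifier are definable.\<close>

datatype fm =
    Eq nat nat
  | Rel nat "nat list"
  | Var nat "nat list"
  | Neg fm
  | Conj fm fm
  | Ex nat fm
  | Lfp nat "nat list" fm "nat list"

primrec free_vars :: "fm \<Rightarrow> nat set" where
  "free_vars (Eq x y) = {x, y}"
| "free_vars (Rel i xs) = set xs"
| "free_vars (Var X xs) = set xs"
| "free_vars (Neg \<phi>) = free_vars \<phi>"
| "free_vars (Conj \<phi> \<psi>) = free_vars \<phi> \<union> free_vars \<psi>"
| "free_vars (Ex x \<phi>) = free_vars \<phi> - {x}"
| "free_vars (Lfp X xs \<phi> ts) = (free_vars \<phi> - set xs) \<union> set ts"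

text \<open>\<open>polarity True X \<phi>\<close>: every free occurrence of \<open>X\<close> in \<open>\<phi>\<close> is under an even number of
  negations; \<open>polarity False X \<phi>\<close>: under an odd number.\<close>

primrec polarity :: "bool \<Rightarrow> nat \<Rightarrow> fm \<Rightarrow> bool" where
  "polarity b X (Eq x y) = True"
| "polarity b X (Rel i xs) = True"
| "polarity b X (Var Y xs) = (X = Y \<longrightarrow> b)"
| "polarity b X (Neg \<phi>) = polarity (\<not> b) X \<phi>"
| "polarity b X (Conj \<phi> \<psi>) = (polarity b X \<phi> \<and> polarity b X \<psi>)"
| "polarity b X (Ex x \<phi>) = polarity b X \<phi>"
| "polarity b X (Lfp Y xs \<phi> ts) = (X = Y \<or> polarity b X \<phi>)"

text \<open>\<open>\<Gamma>\<close> records the arities of the second-order variables in scope.\<close>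

primrec wf_fm :: "vocabulary \<Rightarrow> (nat \<Rightarrow> nat option) \<Rightarrow> fm \<Rightarrow> bool" where
  "wf_fm \<tau> \<Gamma> (Eq x y) = True"
| "wf_fm \<tau> \<Gamma> (Rel i xs) = (i < length \<tau> \<and> length xs = \<tau> ! i)"
| "wf_fm \<tau> \<Gamma> (Var X xs) = (\<Gamma> X = Some (length xs))"
| "wf_fm \<tau> \<Gamma> (Neg \<phi>) = wf_fm \<tau> \<Gamma> \<phi>"
| "wf_fm \<tau> \<Gamma> (Conj \<phi> \<psi>) = (wf_fm \<tau> \<Gamma> \<phi> \<and> wf_fm \<tau> \<Gamma> \<psi>)"
| "wf_fm \<tau> \<Gamma> (Ex x \<phi>) = wf_fm \<tau> \<Gamma> \<phi>"
| "wf_fm \<tau> \<Gamma> (Lfp X xs \<phi> ts) =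
     (distinct xs \<and> length ts = length xs \<and> polarity True X \<phi> \<and>
      wf_fm \<tau> (\<Gamma>(X \<mapsto> length xs)) \<phi>)"

definition lfp_sentence :: "vocabulary \<Rightarrow> fm \<Rightarrow> bool" where
  "lfp_sentence \<tau> \<phi> \<longleftrightarrow> wf_fm \<tau> Map.empty \<phi> \<and> free_vars \<phi> = {}"

definition upd_list :: "(nat \<Rightarrow> 'a) \<Rightarrow> nat list \<Rightarrow> 'a list \<Rightarrow> nat \<Rightarrow> 'a" where
  "upd_list \<sigma> xs as = (\<lambda>x. case map_of (zip xs as) x of None \<Rightarrow> \<sigma> x | Some a \<Rightarrow> a)"

primrec sat :: "'a struct \<Rightarrow> (nat \<Rightarrow> 'a list set) \<Rightarrow> (nat \<Rightarrow> 'a) \<Rightarrow> fm \<Rightarrow> bool" where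
  "sat A \<rho> \<sigma> (Eq x y) = (\<sigma> x = \<sigma> y)"
| "sat A \<rho> \<sigma> (Rel i xs) = (map \<sigma> xs \<in> rel A i)"
| "sat A \<rho> \<sigma> (Var X xs) = (map \<sigma> xs \<in> \<rho> X)"
| "sat A \<rho> \<sigma> (Neg \<phi>) = (\<not> sat A \<rho> \<sigma> \<phi>)"
| "sat A \<rho> \<sigma> (Conj \<phi> \<psi>) = (sat A \<rho> \<sigma> \<phi> \<and> sat A \<rho> \<sigma> \<psi>)"
| "sat A \<rho> \<sigma> (Ex x \<phi>) = (\<exists>a \<in> univ A. sat A \<rho> (\<sigma>(x := a)) \<phi>)"
| "sat A \<rho> \<sigma> (Lfp X xs \<phi> ts) =
     (map \<sigma> ts \<in> lfp (\<lambda>S. {as. length as = length xs \<and> set as \<subseteq> univ A \<and>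
                               sat A (\<rho>(X := S)) (upd_list \<sigma> xs as) \<phi>}))"

text \<open>For a sentence the assignments \<open>\<rho>\<close> and \<open>\<sigma>\<close> are irrelevant.\<close>

definition models :: "'a struct \<Rightarrow> fm \<Rightarrow> bool" where
  "models A \<phi> \<longleftrightarrow> (\<forall>\<sigma>. range \<sigma> \<subseteq> univ A \<longrightarrow> sat A (\<lambda>_. {}) \<sigma> \<phi>)"

text \<open>Positivity makes the operator in the last clause of \<open>sat\<close> monotone, so that \<open>lfp\<close> is
  indeed its least fixed point.\<close>

lemma sat_polarity:
  assumes "S \<subseteq> T" and "polarity b X \<phi>"
  shows "sat A (\<rho>(X := if b then S else T)) \<sigma> \<phi> \<Longrightarrow> sat A (\<rho>(X := if b then T else S)) \<sigma> \<phi>"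
  using assms(2)
proof (induction \<phi> arbitrary: b \<rho> \<sigma>)
  case (Var Y xs)
  then show ?case using assms(1) by (auto split: if_splits)
next
  case (Neg \<phi>)
  then show ?case using Neg.IH[where b = "\<not> b"] by (cases b) auto
next
  case (Ex x \<phi>)
  then show ?case unfolding sat.simps polarity.simps by blast
next
  case (Lfp Y xs \<phi> ts)
  show ?case
  proof (cases "X = Y")
    case True
    show ?thesis using Lfp.prems(1) unfolding True sat.simps fun_upd_upd .
  next
    case False
    define F where "F = (\<lambda>U V. {as. length as = length xs \<and> set as \<subseteq> univ A \<and>
                               sat A (\<rho>(X := U, Y := V)) (upd_list \<sigma> xs as) \<phi>})"
    have pol: "polarity b X \<phi>" using Lfp.prems(2) False by simp
    have "F (if b then S else T) V \<subseteq> F (if b then T else S) V" for V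
      using Lfp.IH[where \<rho> = "\<rho>(Y := V)", OF _ pol] unfolding F_def fun_upd_twist[OF False] by blast
    then have "lfp (F (if b then S else T)) \<subseteq> lfp (F (if b then T else S))"
      by (rule lfp_mono)
    then show ?thesis using Lfp.prems(1) unfolding F_def sat.simps by blast
  qed
qed auto

lemma mono_lfp_operator:
  assumes "wf_fm \<tau> \<Gamma> (Lfp X xs \<phi> ts)"
  shows "mono (\<lambda>S. {as. length as = length xs \<and> set as \<subseteq> univ A \<and>
                        sat A (\<rho>(X := S)) (upd_list \<sigma> xs as) \<phi>})"
proof (rule monoI)
  fix S T :: "'a list set"
  assume "S \<subseteq> T"
  moreover have "polarity True X \<phi>" using assms by simp
  ultimately show "{as. length as = length xs \<and> set as \<subseteq> univ A \<and>
        sat A (\<rho>(X := S)) (upd_list \<sigma> xs as) \<phi>}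
    \<subseteq> {as. length as = length xs \<and> set as \<subseteq> univ A \<and>
        sat A (\<rho>(X := T)) (upd_list \<sigma> xs as) \<phi>}"
    using sat_polarity[of S T True X \<phi> A \<rho>] by auto
qed

text \<open>Deterministic multi-tape Turing machines with two-way infinite tapes. States are
  \<open>0, \<dots>, nstates - 1\<close> and tape symbols \<open>0, \<dots>, nsymbols - 1\<close>; symbol 0 is the blank and the
  input letters are 1 and 2. The transition function maps a state and the list of scanned
  symbols (one per tape) to a new state, the symbols written and the head moves.\<close>

datatype move = Left | Stay | Right

record tm =
  ntapes :: nat
  nstates :: nat
  nsymbols :: nat
  start :: nat
  accept :: nat
  reject :: nat
  delta :: "nat \<Rightarrow> nat list \<Rightarrow> nat \<times> nat list \<times> move list"

definition wf_tm :: "tm \<Rightarrow> bool" where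
  "wf_tm M \<longleftrightarrow> ntapes M \<ge> 1 \<and> nsymbols M \<ge> 3 \<and>
     start M < nstates M \<and> accept M < nstates M \<and> reject M < nstates M \<and>
     accept M \<noteq> reject M \<and>
     (\<forall>q < nstates M. \<forall>ss. length ss = ntapes M \<and> set ss \<subseteq> {..<nsymbols M} \<longrightarrow>
        (case delta M q ss of (q', ws, ms) \<Rightarrow>
           q' < nstates M \<and> length ws = ntapes M \<and> set ws \<subseteq> {..<nsymbols M} \<and>
           length ms = ntapes M))"

text \<open>A tape is its content together with the position of the head.\<close>

type_synonym tape = "(int \<Rightarrow> nat) \<times> int"
type_synonym config = "nat \<times> tape list"

primrec shift :: "move \<Rightarrow> int" where
  "shift Left = -1"
| "shift Stay = 0"
| "shift Right = 1"

fun act :: "tape \<Rightarrow> nat \<times> move \<Rightarrow> tape" where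
  "act (t, h) (w, m) = (t(h := w), h + shift m)"

definition halted :: "tm \<Rightarrow> config \<Rightarrow> bool" where
  "halted M c \<longleftrightarrow> fst c = accept M \<or> fst c = reject M"

definition step :: "tm \<Rightarrow> config \<Rightarrow> config" where
  "step M c = (if halted M c then c else
     (case delta M (fst c) (map (\<lambda>(t, h). t h) (snd c)) of (q', ws, ms) \<Rightarrow>
        (q', map2 act (snd c) (zip ws ms))))"

definition input_tape :: "bool list \<Rightarrow> tape" where
  "input_tape w =
     ((\<lambda>i. if 0 \<le> i \<and> i < int (length w) then (if w ! nat i then 2 else 1) else 0), 0)"

definition init :: "tm \<Rightarrow> bool list \<Rightarrow> config" where
  "init M w = (start M, input_tape w # replicate (ntapes M - 1) (\<lambda>_. 0, 0))"

text \<open>As halted configurations are left unchanged by \<open>step\<close>, being halted after \<open>n\<close> iterations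
  means halting within \<open>n\<close> steps.\<close>

definition ptime :: "bool list set \<Rightarrow> bool" where
  "ptime L \<longleftrightarrow> (\<exists>M (p :: nat poly). wf_tm M \<and>
     (\<forall>w. let c = (step M ^^ poly p (length w)) (init M w)
          in halted M c \<and> (fst c = accept M \<longleftrightarrow> w \<in> L)))"

text \<open>The usual binary encoding of a structure relative to an enumeration \<open>xs\<close> of its universe:
  the size in unary, followed by the characteristic sequences of the relations, the tuples
  being listed in lexicographic order with respect to \<open>xs\<close>.\<close>

definition encode :: "vocabulary \<Rightarrow> 'a list \<Rightarrow> 'a struct \<Rightarrow> bool list" where
  "encode \<tau> xs A = replicate (length xs) False @ [True] @
     concat (map (\<lambda>i. map (\<lambda>as. as \<in> rel A i) (product_lists (replicate (\<tau> ! i) xs)))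
                 [0..<length \<tau>])"

definition ptime_class :: "vocabulary \<Rightarrow> 'a struct set \<Rightarrow> bool" where
  "ptime_class \<tau> C \<longleftrightarrow>
     ptime {encode \<tau> xs A | xs A. A \<in> C \<and> distinct xs \<and> set xs = univ A}"

end

theory Submission
  imports Defs "HOL-Library.Product_Order"
begin

text \<open>For structures with a unary relation (the sources) and a binary relation \<open>E\<close>, call a structure
  short if some source is joined to some source by an \<open>E\<close>-walk whose length \<open>l \<ge> 1\<close> satisfies
  \<open>2 * l < |A| + 2\<close>. Shortness passes to extensions, so the structures that are not short form a
  class closed under substructures; breadth-first search decides it in polynomial time. A directed
  cycle of length \<open>k\<close> through one source together with \<open>m\<close> isolated elements is short iff
  \<open>k < m + 2\<close>. As the isolated elements form a pure set, an \<open>FO(LFP)\<close> sentence with few variables cannot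
  tell a large \<open>m\<close> from \<open>m + 1\<close>, and so it does not define the class.\<close>

section \<open>Pebble games and least fixed points\<close>

text \<open>\<open>FO(LFP)\<close> expresses reachability, so the class must rest on something the
  logic cannot do: counting unordered elements. Most counting properties are not closed under
  substructures; comparing a distance with the size is, because adding elements only loosens the
  bound. The factor 2 lets the number of isolated elements decide: a bound of the form l < |A| + 2
  holds for every cycle, as k \<le> k + m, whereas 2 * k < k + m + 2 really compares k with m. Both
  structures compared contain the same cycle, and every partial isomorphism considered fixes it
  pointwise, so the distances along the cycle never enter the game.

  Fixed points are not unfolded into stages indexed by ordinals; the two least fixed points are
  related by a single induction over pairs of sets. On the machine side the invariant also bounds
  the elapsed time, so that correctness and termination come from the same induction.\<close>

text \<open>The least fixed point of \<open>map_prod F G\<close> on the product lattice is the pair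
  of least fixed points, so ordinary fixed point induction on the product runs both iterations in
  lockstep.\<close>

lemma lfp_pair_induct:
  fixes F :: "'a::complete_lattice \<Rightarrow> 'a" and G :: "'b::complete_lattice \<Rightarrow> 'b"
  assumes F: "mono F" and G: "mono G"
    and step: "\<And>S T. P S T \<Longrightarrow> P (F S) (G T)"
    and Sup: "\<And>M. (\<And>S T. (S, T) \<in> M \<Longrightarrow> P S T) \<Longrightarrow> P (Sup (fst ` M)) (Sup (snd ` M))"
  shows "P (lfp F) (lfp G)"
proof -
  define H where "H = map_prod F G"
  have H: "mono H"
    using F G by (auto simp: H_def mono_def)
  have "lfp H = (lfp F, lfp G)"
  proof (rule lfp_eqI[OF H])
    show "H (lfp F, lfp G) = (lfp F, lfp G)"
      using lfp_unfold[OF F] lfp_unfold[OF G] by (simp add: H_def)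
    fix z assume "H z = z"
    then show "(lfp F, lfp G) \<le> z"
      by (cases z) (auto simp: H_def intro!: lfp_lowerbound)
  qed
  moreover have "case_prod P (lfp H)"
    by (rule lfp_ordinal_induct[OF H])
      (auto simp: H_def Sup_prod_def intro!: step Sup)
  ultimately show ?thesis by simp
qed

section \<open>Back-and-forth systems and formulas of bounded width\<close>

text \<open>Bounds the number of pairs added to a position on the way down to an atom. An
  \<open>Lfp\<close> pays for its tuple only once, however long the iteration: stages are compared
  through \<open>agree\<close>, never unfolded.\<close>

primrec width :: "fm \<Rightarrow> nat" where
  "width (Eq x y) = 0"
| "width (Rel i xs) = 0"
| "width (Var X xs) = 0"
| "width (Neg \<phi>) = width \<phi>"
| "width (Conj \<phi> \<psi>) = max (width \<phi>) (width \<psi>)"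
| "width (Ex x \<phi>) = Suc (width \<phi>)"
| "width (Lfp X xs \<phi> ts) = length xs + width \<phi>"

text \<open>A family of partial isomorphisms with positions as sets of pairs. \<open>I\<close>
  itself carries no size bound; \<open>K\<close> limits only the two extension clauses.\<close>

locale back_and_forth =
  fixes A :: "'a struct" and B :: "'b struct" and K :: nat
    and I :: "('a \<times> 'b) set \<Rightarrow> bool"
  assumes subset: "I q \<Longrightarrow> p \<subseteq> q \<Longrightarrow> I p"
    and univ: "I p \<Longrightarrow> p \<subseteq> univ A \<times> univ B"
    and inj: "I p \<Longrightarrow> (a, b) \<in> p \<Longrightarrow> (a', b') \<in> p \<Longrightarrow> a = a' \<longleftrightarrow> b = b'"
    and rel: "I p \<Longrightarrow> length as = length bs \<Longrightarrow> set (zip as bs) \<subseteq> p \<Longrightarrow>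
      as \<in> rel A i \<longleftrightarrow> bs \<in> rel B i"
    and extend_left: "I p \<Longrightarrow> finite p \<Longrightarrow> card p < K \<Longrightarrow> a \<in> univ A \<Longrightarrow> \<exists>b \<in> univ B. I (insert (a, b) p)"
    and extend_right: "I p \<Longrightarrow> finite p \<Longrightarrow> card p < K \<Longrightarrow> b \<in> univ B \<Longrightarrow> \<exists>a \<in> univ A. I (insert (a, b) p)"
begin

text \<open>An \<open>Lfp\<close> formula may have first-order parameters, so its fixed points on the two sides
  correspond only relative to the pairs \<open>p\<close> fixed outside of it.\<close>

definition agree :: "('a \<times> 'b) set \<Rightarrow> 'a list set \<Rightarrow> 'b list set \<Rightarrow> bool" where
  "agree p S T \<longleftrightarrow> (\<forall>as bs. length as = length bs \<longrightarrow> I (p \<union> set (zip as bs)) \<longrightarrow>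
     (as \<in> S \<longleftrightarrow> bs \<in> T))"

lemma agree_mono: "agree p S T \<Longrightarrow> p \<subseteq> q \<Longrightarrow> agree q S T"
  unfolding agree_def by (meson Un_mono subset subset_refl)

lemma agree_Sup:
  assumes "\<And>S T. (S, T) \<in> M \<Longrightarrow> agree p S T"
  shows "agree p (\<Union> (fst ` M)) (\<Union> (snd ` M))"
  using assms unfolding agree_def by (fastforce simp: image_iff)

lemma upd_list_pairs:
  assumes "\<And>v. v \<in> V - set xs \<Longrightarrow> (\<sigma> v, \<sigma>' v) \<in> p"
    and len: "length as = length xs" "length xs = length bs" and "v \<in> V"
  shows "(upd_list \<sigma> xs as v, upd_list \<sigma>' xs bs v) \<in> p \<union> set (zip as bs)"
proof -
  have "v \<notin> set xs \<and> map_of (zip xs as) v = None \<and> map_of (zip xs bs) v = None \<or>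
    (\<exists>a b. map_of (zip xs as) v = Some a \<and> map_of (zip xs bs) v = Some b \<and>
       (a, b) \<in> set (zip as bs))"
    using len by (induction as xs bs rule: list_induct3) auto
  then show ?thesis
    using assms(1)[of v] \<open>v \<in> V\<close> by (auto simp: upd_list_def split: option.splits)
qed

text \<open>Positions only grow: when a variable is rebound its old pair stays in \<open>p\<close>,
  so the budget \<open>K\<close> is spent on nested binders. Only \<open>Ex\<close> needs the
  extension clauses. In the \<open>Lfp\<close> case the extended position is given by
  \<open>agree\<close>, and what must be shown is that one application of the operators preserves
  \<open>agree p\<close>.\<close>

lemma sat_iff:
  assumes "I p" and "finite p" and "card p + width \<phi> \<le> K"
    and "\<And>X. agree p (\<rho> X) (\<rho>' X)" and "\<And>v. v \<in> free_vars \<phi> \<Longrightarrow> (\<sigma> v, \<sigma>' v) \<in> p"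
    and "wf_fm \<tau> \<Gamma> \<phi>"
  shows "sat A \<rho> \<sigma> \<phi> \<longleftrightarrow> sat B \<rho>' \<sigma>' \<phi>"
  using assms
proof (induction \<phi> arbitrary: p \<rho> \<rho>' \<sigma> \<sigma>' \<Gamma>)
  case (Eq x y)
  then show ?case using inj[of p] by simp
next
  case (Rel i xs)
  have "set (zip (map \<sigma> xs) (map \<sigma>' xs)) \<subseteq> p"
    using Rel.prems(5) by (auto simp: zip_map_map zip_same_conv_map)
  then show ?case using rel[OF Rel.prems(1)] by simp
next
  case (Var X xs)
  have "set (zip (map \<sigma> xs) (map \<sigma>' xs)) \<subseteq> p"
    using Var.prems(5) by (auto simp: zip_map_map zip_same_conv_map)
  then have "p \<union> set (zip (map \<sigma> xs) (map \<sigma>' xs)) = p" by blast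
  then show ?case using Var.prems(1,4) unfolding agree_def by (metis length_map sat.simps(3))
next
  case (Neg \<phi>)
  have "sat A \<rho> \<sigma> \<phi> \<longleftrightarrow> sat B \<rho>' \<sigma>' \<phi>"
    by (rule Neg.IH[where p = p and \<Gamma> = \<Gamma>]) (use Neg.prems in auto)
  then show ?case by simp
next
  case (Conj \<phi> \<psi>)
  have "sat A \<rho> \<sigma> \<phi> \<longleftrightarrow> sat B \<rho>' \<sigma>' \<phi>"
    by (rule Conj.IH(1)[where p = p and \<Gamma> = \<Gamma>]) (use Conj.prems in auto)
  moreover have "sat A \<rho> \<sigma> \<psi> \<longleftrightarrow> sat B \<rho>' \<sigma>' \<psi>"
    by (rule Conj.IH(2)[where p = p and \<Gamma> = \<Gamma>]) (use Conj.prems in auto)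
  ultimately show ?case by simp
next
  case (Ex x \<phi>)
  have *: "sat A \<rho> (\<sigma>(x := a)) \<phi> \<longleftrightarrow> sat B \<rho>' (\<sigma>'(x := b)) \<phi>" if "I (insert (a, b) p)" for a b
  proof (rule Ex.IH[where \<Gamma> = \<Gamma>, OF that])
    show "card (insert (a, b) p) + width \<phi> \<le> K"
      using Ex.prems(2,3) by (simp add: card_insert_if)
    show "agree (insert (a, b) p) (\<rho> X) (\<rho>' X)" for X
      using Ex.prems(4) by (rule agree_mono) blast
  qed (use Ex.prems in auto)
  have "card p < K" using Ex.prems(3) by simp
  then show ?case
    using * extend_left[OF Ex.prems(1,2)] extend_right[OF Ex.prems(1,2)] unfolding sat.simps by meson
next
  case (Lfp X xs \<phi> ts)
  define F where "F = (\<lambda>S. {as. length as = length xs \<and> set as \<subseteq> univ A \<and>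
    sat A (\<rho>(X := S)) (upd_list \<sigma> xs as) \<phi>})"
  define G where "G = (\<lambda>T. {bs. length bs = length xs \<and> set bs \<subseteq> univ B \<and>
    sat B (\<rho>'(X := T)) (upd_list \<sigma>' xs bs) \<phi>})"
  have "agree p (lfp F) (lfp G)"
  proof (rule lfp_pair_induct)
    show "mono F" "mono G"
      unfolding F_def G_def by (rule mono_lfp_operator[OF Lfp.prems(6)])+
    fix S T assume ST: "agree p S T"
    show "agree p (F S) (G T)"
      unfolding agree_def
    proof (intro allI impI)
      fix as bs
      assume len: "length as = length bs" and p': "I (p \<union> set (zip as bs))" (is "I ?p'")
      have "set as \<subseteq> univ A" "set bs \<subseteq> univ B"
        using univ[OF p'] set_zip_leftD set_zip_rightD len
        by (auto simp: in_set_conv_nth set_zip subset_iff)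
      \<comment> \<open>Tuples of any other length belong to neither stage.\<close>
      moreover have "sat A (\<rho>(X := S)) (upd_list \<sigma> xs as) \<phi> \<longleftrightarrow>
          sat B (\<rho>'(X := T)) (upd_list \<sigma>' xs bs) \<phi>" if "length as = length xs"
      proof (rule Lfp.IH[OF p'])
        have "card (set (zip as bs)) \<le> length xs"
          using card_length[of "zip as bs"] that len by simp
        then show "card ?p' + width \<phi> \<le> K"
          using Lfp.prems(3) card_Un_le[of p "set (zip as bs)"] by simp
        show "agree ?p' ((\<rho>(X := S)) Y) ((\<rho>'(X := T)) Y)" for Y
          by (rule agree_mono[of p]) (use ST Lfp.prems(4) in auto)
        show "(upd_list \<sigma> xs as v, upd_list \<sigma>' xs bs v) \<in> ?p'" if "v \<in> free_vars \<phi>" for v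
          by (rule upd_list_pairs[OF _ _ _ that])
            (use Lfp.prems(5) len \<open>length as = length xs\<close> in auto)
        show "wf_fm \<tau> (\<Gamma>(X \<mapsto> length xs)) \<phi>"
          using Lfp.prems(6) by simp
      qed (use Lfp.prems(2) in simp)
      ultimately show "as \<in> F S \<longleftrightarrow> bs \<in> G T"
        using len by (auto simp: F_def G_def)
    qed
  qed (rule agree_Sup)
  \<comment> \<open>The variables \<open>ts\<close> are free in the formula, so their pairs already
    lie in \<open>p\<close> and \<open>agree\<close> can be used at \<open>p\<close> itself.\<close>
  moreover have "set (zip (map \<sigma> ts) (map \<sigma>' ts)) \<subseteq> p"
    using Lfp.prems(5) by (auto simp: zip_map_map zip_same_conv_map)
  then have "p \<union> set (zip (map \<sigma> ts) (map \<sigma>' ts)) = p" by blast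
  ultimately have "map \<sigma> ts \<in> lfp F \<longleftrightarrow> map \<sigma>' ts \<in> lfp G"
    using Lfp.prems(1) unfolding agree_def by (metis length_map)
  then show ?case by (simp add: F_def G_def)
qed

end

section \<open>Short structures\<close>

text \<open>The walk has length l = \<open>Suc s\<close>, which excludes the empty walk from a
  source to itself. In terms of \<open>s\<close> the bound 2 * l < |A| + 2 is the test that the
  machine makes in round \<open>s\<close>.\<close>

definition short :: "'a struct \<Rightarrow> bool" where
  "short A \<longleftrightarrow> (\<exists>s x y. 2 * s < card (univ A) \<and> [x] \<in> rel A 0 \<and> [y] \<in> rel A 0 \<and>
     (x, y) \<in> {(u, v). [u, v] \<in> rel A 1} ^^ Suc s)"

text \<open>The cycle occupies the numbers below \<open>k\<close> and the isolated elements follow,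
  so the relations do not depend on \<open>m\<close>.\<close>

definition cycle :: "nat \<Rightarrow> nat \<Rightarrow> nat struct" where
  "cycle k m = \<lparr>univ = {..<k + m},
     rel = (\<lambda>_. {})(0 := {[0]}, 1 := {[i, Suc i mod k] | i. i < k})\<rparr>"

lemma cycle_fin_structs: "0 < k \<Longrightarrow> cycle k m \<in> fin_structs [1, 2]"
  by (auto simp: fin_structs_def cycle_def nth_Cons' less_Suc_eq trans_less_add1)

text \<open>The only walk of length \<open>s\<close> from the source ends in \<open>s mod k\<close>,
  so it returns iff \<open>k\<close> divides its length. The first return is
  \<open>s = k - 1\<close>, where 2 * (k - 1) < k + m says k < m + 2.\<close>

lemma short_cycle:
  assumes "0 < k"
  shows "short (cycle k m) \<longleftrightarrow> k < m + 2"
proof -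
  let ?E = "{(i, Suc i mod k) | i. i < k}"
  have E: "{(u, v). [u, v] \<in> rel (cycle k m) 1} = ?E"
    by (auto simp: cycle_def)
  have walk: "(0, y) \<in> ?E ^^ s \<longleftrightarrow> y = s mod k" for y s
  proof (induction s arbitrary: y)
    case (Suc s)
    have "(0, y) \<in> ?E ^^ Suc s \<longleftrightarrow> (s mod k, y) \<in> ?E"
      using Suc.IH by auto
    also have "\<dots> \<longleftrightarrow> y = Suc s mod k"
      using assms by (auto simp: mod_Suc_eq)
    finally show ?case .
  qed auto
  have "short (cycle k m) \<longleftrightarrow> (\<exists>s. 2 * s < k + m \<and> k dvd Suc s)"
  proof -
    have "short (cycle k m) \<longleftrightarrow> (\<exists>s. 2 * s < k + m \<and> (0, 0) \<in> ?E ^^ Suc s)"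
      unfolding short_def E by (simp add: cycle_def del: relpow.simps)
    also have "\<dots> \<longleftrightarrow> (\<exists>s. 2 * s < k + m \<and> k dvd Suc s)"
      unfolding walk by (auto simp: dvd_eq_mod_eq_0)
    finally show ?thesis .
  qed
  also have "\<dots> \<longleftrightarrow> k < m + 2"
  proof
    assume "\<exists>s. 2 * s < k + m \<and> k dvd Suc s"
    then obtain s where "2 * s < k + m" "k \<le> Suc s" by (auto dest: dvd_imp_le)
    then show "k < m + 2" by linarith
  next
    assume "k < m + 2"
    then have "2 * (k - 1) < k + m \<and> k dvd Suc (k - 1)" using assms by auto
    then show "\<exists>s. 2 * s < k + m \<and> k dvd Suc s" by blast
  qed
  finally show ?thesis .
qed

section \<open>Partial isomorphisms between cycles with isolated elements\<close>

text \<open>Partial injections that are the identity wherever they touch the cycle. Between isolated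
  elements nothing but injectivity has to be respected.\<close>

definition cycle_iso :: "nat \<Rightarrow> nat \<Rightarrow> nat \<Rightarrow> (nat \<times> nat) set \<Rightarrow> bool" where
  "cycle_iso k m m' p \<longleftrightarrow> p \<subseteq> {..<k + m} \<times> {..<k + m'} \<and> single_valued p \<and> single_valued (p\<inverse>) \<and>
     (\<forall>(a, b) \<in> p. a < k \<or> b < k \<longrightarrow> a = b)"

lemma cycle_iso_fixed: "cycle_iso k m m' p \<Longrightarrow> (a, b) \<in> p \<Longrightarrow> a < k \<or> b < k \<Longrightarrow> a = b"
  by (auto simp: cycle_iso_def)

lemma cycle_iso_subset: "cycle_iso k m m' q \<Longrightarrow> p \<subseteq> q \<Longrightarrow> cycle_iso k m m' p"
  by (auto simp: cycle_iso_def intro: single_valued_subset[of p q] single_valued_subset[of "p\<inverse>" "q\<inverse>"])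

lemma cycle_iso_converse: "cycle_iso k m m' p \<Longrightarrow> cycle_iso k m' m (p\<inverse>)"
  by (auto simp: cycle_iso_def)

lemma cycle_iso_insert:
  assumes "cycle_iso k m m' p" and "a < k + m" and "b < k + m'"
    and "a \<notin> fst ` p" and "b \<notin> snd ` p" and "a < k \<or> b < k \<Longrightarrow> a = b"
  shows "cycle_iso k m m' (insert (a, b) p)"
  using assms by (auto simp: cycle_iso_def single_valued_def image_iff)

lemma cycle_iso_extend:
  assumes p: "cycle_iso k m m' p" "finite p" "card p < m'" and a: "a < k + m"
  shows "\<exists>b < k + m'. cycle_iso k m m' (insert (a, b) p)"
proof (cases "a \<in> fst ` p")
  case True
  then obtain b where "(a, b) \<in> p" by force
  moreover from this have "b < k + m'" using p(1) by (auto simp: cycle_iso_def)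
  ultimately show ?thesis using p(1) by (intro exI[of _ b]) (simp add: insert_absorb)
next
  case new: False
  show ?thesis
  proof (cases "a < k")
    case True
    then have "a \<notin> snd ` p" using new cycle_iso_fixed[OF p(1)] by force
    with True show ?thesis using cycle_iso_insert[OF p(1) a, of a] new by auto
  next
    case False
    have "card (snd ` p) \<le> card p" using p(2) by (rule card_image_le)
    then have "card (snd ` p) < card {k..<k + m'}" using p(3) by simp
    then obtain b where "b \<in> {k..<k + m'}" "b \<notin> snd ` p"
      using p(2) by (meson card_mono finite_imageI not_less subsetI)
    with False show ?thesis using cycle_iso_insert[OF p(1) a, of b] new by auto
  qed
qed

text \<open>Related tuples lie inside the cycle, where \<open>p\<close> is the identity, so atoms
  are preserved because the two tuples are equal. The extension on the right is the one on the left
  for the converse relation.\<close>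

lemma back_and_forth_cycle:
  assumes "0 < k"
  shows "back_and_forth (cycle k m) (cycle k m') (min m m') (cycle_iso k m m')"
proof
  fix p q :: "(nat \<times> nat) set"
  assume "cycle_iso k m m' q" "p \<subseteq> q"
  then show "cycle_iso k m m' p" by (rule cycle_iso_subset)
next
  fix p assume "cycle_iso k m m' p"
  then show "p \<subseteq> univ (cycle k m) \<times> univ (cycle k m')" by (simp add: cycle_iso_def cycle_def)
next
  fix p a b a' b'
  assume "cycle_iso k m m' p" "(a, b) \<in> p" "(a', b') \<in> p"
  then show "a = a' \<longleftrightarrow> b = b'" by (auto simp: cycle_iso_def single_valued_def)
next
  fix p as bs i
  assume p: "cycle_iso k m m' p" and len: "length as = length bs" and sub: "set (zip as bs) \<subseteq> p"
  have eq: "as = bs" if "set as \<subseteq> {..<k} \<or> set bs \<subseteq> {..<k}"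
  proof (rule nth_equalityI[OF len])
    fix j assume j: "j < length as"
    then have "(as ! j, bs ! j) \<in> p" using sub len by (auto simp: set_zip)
    moreover have "as ! j < k \<or> bs ! j < k" using that j len by (metis lessThan_iff nth_mem subsetD)
    ultimately show "as ! j = bs ! j" by (rule cycle_iso_fixed[OF p])
  qed
  have "set cs \<subseteq> {..<k}" if "cs \<in> rel (cycle k n) i" for cs n
    using that assms by (auto simp: cycle_def split: if_splits)
  moreover have "rel (cycle k m) i = rel (cycle k m') i" by (simp add: cycle_def)
  ultimately show "as \<in> rel (cycle k m) i \<longleftrightarrow> bs \<in> rel (cycle k m') i"
    using eq by metis
next
  fix p a assume "cycle_iso k m m' p" "finite p" "card p < min m m'" "a \<in> univ (cycle k m)"
  then show "\<exists>b \<in> univ (cycle k m'). cycle_iso k m m' (insert (a, b) p)"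
    using cycle_iso_extend[of k m m' p a] by (simp add: cycle_def Bex_def)
next
  fix p b assume p: "cycle_iso k m m' p" "finite p" "card p < min m m'" "b \<in> univ (cycle k m')"
  then obtain a where a: "a < k + m" "cycle_iso k m' m (insert (b, a) (p\<inverse>))"
    using cycle_iso_extend[OF cycle_iso_converse[OF p(1)], of b] by (auto simp: cycle_def)
  have "(insert (b, a) (p\<inverse>))\<inverse> = insert (a, b) p" by auto
  then show "\<exists>a \<in> univ (cycle k m). cycle_iso k m m' (insert (a, b) p)"
    using a cycle_iso_converse[OF a(2)] by (auto simp: cycle_def)
qed

text \<open>Without free variables the play starts from the empty position, with unrelated
  assignments on the two sides.\<close>

lemma models_cycle:
  assumes "lfp_sentence \<tau> \<phi>" and "width \<phi> \<le> m" and "width \<phi> \<le> m'" and "0 < k"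
  shows "models (cycle k m) \<phi> \<longleftrightarrow> models (cycle k m') \<phi>"
proof -
  interpret back_and_forth "cycle k m" "cycle k m'" "min m m'" "cycle_iso k m m'"
    using assms(4) by (rule back_and_forth_cycle)
  have "sat (cycle k m) (\<lambda>_. {}) \<sigma> \<phi> \<longleftrightarrow> sat (cycle k m') (\<lambda>_. {}) \<sigma>' \<phi>" for \<sigma> \<sigma>'
    by (rule sat_iff[where p = "{}"])
      (use assms in \<open>auto simp: cycle_iso_def agree_def lfp_sentence_def\<close>)
  \<comment> \<open>Some assignment into the universe must exist, since \<open>models\<close> would
    otherwise hold vacuously.\<close>
  moreover have "range (\<lambda>_ :: nat. 0) \<subseteq> univ (cycle k n)" for n
    using assms(4) by (auto simp: cycle_def)
  ultimately show ?thesis unfolding models_def by meson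
qed

lemma short_not_definable:
  assumes "lfp_sentence \<tau> \<phi>"
  shows "{A \<in> fin_structs [1, 2]. \<not> short A} \<noteq> {A :: nat struct \<in> fin_structs [1, 2]. models A \<phi>}"
    (is "?C \<noteq> ?D")
proof
  assume eq: "?C = ?D"
  \<comment> \<open>With this \<open>k\<close> the threshold k < m + 2 falls between m =
    \<open>width \<phi>\<close> and its successor, both of which leave enough isolated elements for
    the game.\<close>
  let ?k = "width \<phi> + 2"
  have "models (cycle ?k m) \<phi> \<longleftrightarrow> \<not> short (cycle ?k m)" for m
  proof -
    have "cycle ?k m \<in> ?C \<longleftrightarrow> cycle ?k m \<in> ?D" unfolding eq ..
    then show ?thesis using cycle_fin_structs[of ?k m] by simp
  qed
  then have "models (cycle ?k (width \<phi>)) \<phi>" "\<not> models (cycle ?k (Suc (width \<phi>))) \<phi>"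
    by (simp_all add: short_cycle)
  then show False using models_cycle[OF assms, of "width \<phi>" "Suc (width \<phi>)" ?k] by simp
qed

section \<open>Closure under isomorphism and substructures\<close>

lemma fin_structs_iff:
  "A \<in> fin_structs [1, 2] \<longleftrightarrow> finite (univ A) \<and> univ A \<noteq> {} \<and>
     (\<forall>as \<in> rel A 0. length as = 1 \<and> set as \<subseteq> univ A) \<and>
     (\<forall>as \<in> rel A 1. length as = 2 \<and> set as \<subseteq> univ A) \<and> (\<forall>i \<ge> 2. rel A i = {})"
  by (simp add: fin_structs_def numeral_2_eq_2 All_less_Suc conj_ac)

lemma isomorphic_iff:
  "isomorphic [1, 2] A B \<longleftrightarrow> (\<exists>f. bij_betw f (univ A) (univ B) \<and>
     (\<forall>a \<in> univ A. \<forall>b \<in> univ A. [a, b] \<in> rel A 1 \<longleftrightarrow> [f a, f b] \<in> rel B 1) \<and>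
     (\<forall>a \<in> univ A. [a] \<in> rel A 0 \<longleftrightarrow> [f a] \<in> rel B 0))"
proof -
  have "(\<forall>as. length as = Suc 0 \<and> set as \<subseteq> U \<longrightarrow> P as) \<longleftrightarrow> (\<forall>a \<in> U. P [a])"
    "(\<forall>as. length as = Suc (Suc 0) \<and> set as \<subseteq> U \<longrightarrow> P as) \<longleftrightarrow> (\<forall>a \<in> U. \<forall>b \<in> U. P [a, b])"
    for U :: "'a set" and P
    by (auto simp: length_Suc_conv)
  then show ?thesis
    by (simp add: isomorphic_def numeral_2_eq_2 All_less_Suc)
qed

text \<open>Walks of \<open>B\<close> are pulled back along the inverse bijection. Their vertices
  must first be located in the universe, since an isomorphism only controls tuples over it.\<close>

lemma iso_closed_short: "iso_closed [1, 2] {A \<in> fin_structs [1, 2]. \<not> short A}"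
  unfolding iso_closed_def
proof safe
  fix A B :: "'a struct"
  assume "\<not> short A" and B: "B \<in> fin_structs [1, 2]"
    and "isomorphic [1, 2] A B" and "short B"
  then obtain f where f: "bij_betw f (univ A) (univ B)"
    and rel: "\<And>a. a \<in> univ A \<Longrightarrow> [a] \<in> rel A 0 \<longleftrightarrow> [f a] \<in> rel B 0"
      "\<And>a b. a \<in> univ A \<Longrightarrow> b \<in> univ A \<Longrightarrow> [a, b] \<in> rel A 1 \<longleftrightarrow> [f a, f b] \<in> rel B 1"
    unfolding isomorphic_iff by blast
  define g where "g = the_inv_into (univ A) f"
  have g: "g y \<in> univ A" "f (g y) = y" if "y \<in> univ B" for y
    using that f the_inv_into_into[of f "univ A" y "univ A"] f_the_inv_into_f_bij_betw[OF f]
    by (auto simp: g_def bij_betw_def)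
  have walk: "(g x, g y) \<in> {(u, v). [u, v] \<in> rel A 1} ^^ s"
    if "(x, y) \<in> {(u, v). [u, v] \<in> rel B 1} ^^ s" for x y s
    using that
  proof (induction s arbitrary: y)
    case (Suc s)
    then obtain z where z: "(x, z) \<in> {(u, v). [u, v] \<in> rel B 1} ^^ s" "[z, y] \<in> rel B 1"
      by auto
    then have "z \<in> univ B" "y \<in> univ B" using B unfolding fin_structs_iff by auto
    then have "[g z, g y] \<in> rel A 1" using rel(2)[of "g z" "g y"] z(2) g by simp
    with Suc.IH[OF z(1)] show ?case by auto
  qed simp
  have "[g x] \<in> rel A 0" if "[x] \<in> rel B 0" for x
  proof -
    have "x \<in> univ B" using B that unfolding fin_structs_iff by auto
    then show ?thesis using rel(1)[of "g x"] that g by simp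
  qed
  moreover have "card (univ A) = card (univ B)" using f by (rule bij_betw_same_card)
  ultimately have "short A"
    using \<open>short B\<close> walk unfolding short_def by metis
  with \<open>\<not> short A\<close> show False ..
qed

lemma substructure_closed_short:
  "substructure_closed [1, 2] {A \<in> fin_structs [1, 2]. \<not> short A}"
  unfolding substructure_closed_def
proof safe
  fix A B :: "'a struct"
  assume A: "A \<in> fin_structs [1, 2]" "\<not> short A" and sub: "substructure [1, 2] B A" and "short B"
  have rel: "rel B 0 \<subseteq> rel A 0" "rel B 1 \<subseteq> rel A 1"
    using sub by (auto simp: substructure_def less_Suc_eq)
  then have "{(u, v). [u, v] \<in> rel B 1} ^^ s \<subseteq> {(u, v). [u, v] \<in> rel A 1} ^^ s" for s
    by (induction s) (auto intro!: relcomp_mono)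
  moreover have "card (univ B) \<le> card (univ A)"
    using sub A(1) by (intro card_mono) (auto simp: substructure_def fin_structs_def)
  ultimately have "short A"
    using \<open>short B\<close> rel unfolding short_def by (meson less_le_trans subsetD)
  with A(2) show False ..
qed

section \<open>A Turing machine for breadth-first search\<close>

text \<open>The machine has four tapes: the input, the row tape, the column tape and a counter.
  State 0 consumes the unary size \<open>n\<close>, writing \<open>n\<close> marks on the row tape and on the counter.
  State 1 consumes the unary predicate and moves it to the column tape, whose symbols are 1
  (unmarked), 2 (marked) and 3 (source). State 2 copies the marks and the sources to the row tape
  as 2, everything else as 1. State 3 stops when the counter, which advances by 2 in each round,
  is exhausted. States 4 to 6 sweep once over the adjacency matrix that remains on the input
  tape and mark all successors of the elements marked on the row tape, rejecting if a source is
  among them; state 7 rewinds the input tape.\<close>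

definition transition :: "nat \<Rightarrow> nat \<Rightarrow> nat \<Rightarrow> nat \<Rightarrow> nat \<Rightarrow> nat \<times> nat list \<times> move list" where
  "transition q a b c d = (let rejected = (9, [a, b, c, d], [Stay, Stay, Stay, Stay]) in
     if q = 0 then
       if a = 1 then (0, [0, 1, c, 1], [Right, Right, Stay, Right])
       else if a = 2 then (1, [0, b, c, d], [Right, Stay, Stay, Left])
       else rejected
     else if q = 1 then
       if d = 0 then (2, [a, b, c, d], [Stay, Left, Left, Stay])
       else if a = 0 then rejected
       else (1, [0, b, if a = 2 then 3 else 1, d], [Right, Stay, Right, Left])
     else if q = 2 then
       if b = 0 then (3, [a, b, c, d], [Stay, Right, Right, Right])
       else (2, [a, if c = 1 then 1 else 2, c, d], [Stay, Left, Left, Stay])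
     else if q = 3 then
       if b = 0 then rejected
       else if d = 0 then (8, [a, b, c, d], [Stay, Stay, Stay, Stay])
       else (4, [a, b, c, d], [Stay, Stay, Stay, Stay])
     else if q = 4 then
       if c = 0 then (5, [a, b, c, d], [Stay, Right, Stay, Stay])
       else if a = 0 then rejected
       else if a = 2 \<and> b = 2 \<and> c = 3 then rejected
       else (4, [a, b, if a = 2 \<and> b = 2 then 2 else c, d], [Right, Stay, Right, Stay])
     else if q = 5 then
       if b \<noteq> 0 then (6, [a, b, c, d], [Stay, Stay, Left, Stay])
       else if a \<noteq> 0 then rejected
       else (7, [a, b, c, d], [Left, Stay, Stay, Stay])
     else if q = 6 then
       if c = 0 then (4, [a, b, c, d], [Stay, Stay, Right, Stay])
       else (6, [a, b, c, d], [Stay, Stay, Left, Stay])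
     else
       if a = 0 then (2, [a, b, c, d], [Right, Left, Left, Right])
       else (7, [a, b, c, d], [Left, Stay, Stay, Stay]))"

definition machine :: tm where
  "machine = \<lparr>ntapes = 4, nstates = 10, nsymbols = 4, start = 0, accept = 8, reject = 9,
     delta = (\<lambda>q ss. transition q (ss ! 0) (ss ! 1) (ss ! 2) (ss ! 3))\<rparr>"

lemma wf_machine: "wf_tm machine"
proof -
  have "case transition q (ss ! 0) (ss ! 1) (ss ! 2) (ss ! 3) of (q', ws, ms) \<Rightarrow>
      q' < 10 \<and> length ws = 4 \<and> set ws \<subseteq> {..<4} \<and> length ms = 4"
    if "length ss = 4 \<and> set ss \<subseteq> {..<4}" for q and ss :: "nat list"
  proof -
    have "ss ! i < 4" if "i < 4" for i
      using that \<open>length ss = 4 \<and> set ss \<subseteq> {..<4}\<close> by (metis lessThan_iff nth_mem subsetD)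
    then have "ss ! 0 < 4" "ss ! 1 < 4" "ss ! 2 < 4" "ss ! 3 < 4" by simp_all
    then show ?thesis by (simp add: transition_def Let_def)
  qed
  then show ?thesis
    unfolding wf_tm_def machine_def by simp
qed

lemma step_machine:
  assumes "q < 8"
  shows "step machine (q, [(T0, h0), (T1, h1), (T2, h2), (T3, h3)]) =
    (case transition q (T0 h0) (T1 h1) (T2 h2) (T3 h3) of (q', ws, ms) \<Rightarrow>
       (q', map2 act [(T0, h0), (T1, h1), (T2, h2), (T3, h3)] (zip ws ms)))"
  using assms by (simp add: step_def halted_def machine_def)

text \<open>Every transition writes on all tapes; \<open>fun_upd_idem\<close> turns the rewriting of
  a scanned symbol back into the unchanged tape.\<close>

lemmas step_simps = step_machine transition_def fun_upd_idem

section \<open>Breadth-first search on input words\<close>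

definition size_prefix :: "bool list \<Rightarrow> nat \<Rightarrow> bool" where
  "size_prefix w n \<longleftrightarrow> n < length w \<and> w ! n \<and> (\<forall>k < n. \<not> w ! k)"

definition source :: "bool list \<Rightarrow> nat \<Rightarrow> nat \<Rightarrow> bool" where
  "source w n i = w ! (n + 1 + i)"

definition edge :: "bool list \<Rightarrow> nat \<Rightarrow> nat \<Rightarrow> nat \<Rightarrow> bool" where
  "edge w n i j = w ! (2 * n + 1 + i * n + j)"

text \<open>Cumulative: the vertices at distance at most \<open>s\<close> from a source, not exactly
  \<open>s\<close>. Marks therefore never have to be withdrawn.\<close>

primrec level :: "bool list \<Rightarrow> nat \<Rightarrow> nat \<Rightarrow> nat set" where
  "level w n 0 = {y. y < n \<and> source w n y}"
| "level w n (Suc s) = level w n s \<union> {y. y < n \<and> (\<exists>x \<in> level w n s. edge w n x y)}"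

definition hit :: "bool list \<Rightarrow> nat \<Rightarrow> nat \<Rightarrow> bool" where
  "hit w n s \<longleftrightarrow> (\<exists>x \<in> level w n s. \<exists>y < n. edge w n x y \<and> source w n y)"

text \<open>The accepted language, stated for words so that malformed inputs are covered: the length
  condition and \<open>n > 0\<close> single out the encodings of structures.\<close>

definition good :: "bool list \<Rightarrow> bool" where
  "good w \<longleftrightarrow> (\<exists>n > 0. size_prefix w n \<and> length w = 2 * n + 1 + n * n \<and>
     (\<forall>s. 2 * s < n \<longrightarrow> \<not> hit w n s))"

lemma size_prefix_unique: "size_prefix w n \<Longrightarrow> size_prefix w m \<Longrightarrow> n = m"
  unfolding size_prefix_def by (meson linorder_neqE_nat)

lemma good_iff:
  assumes "size_prefix w n"
  shows "good w \<longleftrightarrow> 0 < n \<and> length w = 2 * n + 1 + n * n \<and> (\<forall>s. 2 * s < n \<longrightarrow> \<not> hit w n s)"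
  using size_prefix_unique[OF assms] assms unfolding good_def by metis

lemma level_less: "x \<in> level w n s \<Longrightarrow> x < n"
  by (induction s) auto

lemma source_in_level: "source w n x \<Longrightarrow> x < n \<Longrightarrow> x \<in> level w n s"
  by (induction s) auto

text \<open>The successors found once the sweep has processed all matrix entries before row
  \<open>i\<close>, column \<open>j\<close>.\<close>

definition seen :: "bool list \<Rightarrow> nat \<Rightarrow> nat \<Rightarrow> nat \<Rightarrow> nat \<Rightarrow> nat set" where
  "seen w n s i j = {y. y < n \<and> (\<exists>x \<in> level w n s. edge w n x y \<and> (x < i \<or> x = i \<and> y < j))}"

lemma seen_0: "seen w n s 0 0 = {}"
  by (simp add: seen_def)

lemma seen_Suc_col:
  assumes "j < n"
  shows "seen w n s i (Suc j) =
    (if i \<in> level w n s \<and> edge w n i j then insert j (seen w n s i j) else seen w n s i j)"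
  using assms by (auto simp: seen_def less_Suc_eq)

lemma seen_Suc_row: "seen w n s (Suc i) 0 = seen w n s i n"
  by (auto simp: seen_def less_Suc_eq)

lemma seen_all: "seen w n s n 0 = {y. y < n \<and> (\<exists>x \<in> level w n s. edge w n x y)}"
  using level_less by (auto simp: seen_def)

section \<open>Contents of the tapes during a run\<close>

definition input_from :: "bool list \<Rightarrow> nat \<Rightarrow> int \<Rightarrow> nat" where
  "input_from w m = (\<lambda>i. if int m \<le> i \<and> i < int (length w) then if w ! nat i then 2 else 1 else 0)"

definition cells :: "nat \<Rightarrow> (nat \<Rightarrow> nat) \<Rightarrow> int \<Rightarrow> nat" where
  "cells n f = (\<lambda>i. if 0 \<le> i \<and> i < int n then f (nat i) else 0)"

text \<open>Symbol 3 may hide the mark of a source because sources belong to every level; for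
  \<open>X\<close> containing a level, any symbol other than 1 still means membership.\<close>

definition col_sym :: "bool list \<Rightarrow> nat \<Rightarrow> nat set \<Rightarrow> nat \<Rightarrow> nat" where
  "col_sym w n X i = (if source w n i then 3 else if i \<in> X then 2 else 1)"

definition row_sym :: "nat set \<Rightarrow> nat \<Rightarrow> nat" where
  "row_sym X i = (if i \<in> X then 2 else 1)"

lemma input_from_at [simp]:
  "input_from w m (int k) = (if m \<le> k \<and> k < length w then if w ! k then 2 else 1 else 0)"
  by (simp add: input_from_def)

lemma input_from_Suc: "(input_from w m)(int m := 0) = input_from w (Suc m)"
  by (auto simp: input_from_def)

lemma cells_at [simp]: "cells n f (int k) = (if k < n then f k else 0)"
  by (simp add: cells_def)

lemma cells_before [simp]: "cells n f (- 1) = 0"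
  by (simp add: cells_def)

lemma cells_Suc: "f n = a \<Longrightarrow> (cells n f)(int n := a) = cells (Suc n) f"
  by (auto simp: cells_def fun_eq_iff nat_eq_iff less_le)

lemma cells_cong: "(\<And>i. i < n \<Longrightarrow> f i = g i) \<Longrightarrow> cells n f = cells n g"
  by (auto simp: cells_def fun_eq_iff)

lemma cells_upd: "k < n \<Longrightarrow> (cells n f)(int k := a) = cells n (f(k := a))"
  by (auto simp: cells_def fun_eq_iff)

section \<open>The run invariant and its preservation\<close>

text \<open>What is known when round \<open>s\<close> begins. The length of the input is verified
  only by the first complete sweep, hence the guard \<open>0 < s\<close>.\<close>

definition ready :: "bool list \<Rightarrow> nat \<Rightarrow> nat \<Rightarrow> bool" where
  "ready w n s \<longleftrightarrow> size_prefix w n \<and> 2 * n + 1 \<le> length w \<and>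
     (0 < s \<longrightarrow> length w = 2 * n + 1 + n * n) \<and> (\<forall>r < s. 2 * r < n \<and> \<not> hit w n r)"

text \<open>An upper bound for the length of a round.\<close>

definition period :: "nat \<Rightarrow> nat" where
  "period N = 2 * N * N + 6 * N + 10"

text \<open>Each non-halting clause describes one state and bounds the elapsed time
  \<open>t\<close>. The bounds start from \<open>Suc s\<close> periods in round \<open>s\<close>
  because loading the input is charged one period. The counter advances by 2 in two single moves,
  one on leaving the rewind and one on leaving the copying; hence its position
  \<open>2 * s - 1\<close> in between, which for \<open>s = 0\<close> is where loading leaves
  it.\<close>

inductive run_inv :: "bool list \<Rightarrow> nat \<Rightarrow> config \<Rightarrow> bool" for w :: "bool list" where
  size: "run_inv w t (0, [(T0, h0), (T1, h1), (T2, h2), (T3, h3)])"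
  if "t \<le> m" "m \<le> length w" "\<forall>k < m. \<not> w ! k"
    "T0 = input_from w m" "h0 = int m" "T1 = cells m (\<lambda>_. 1)" "h1 = int m"
    "T2 = (\<lambda>_. 0)" "h2 = 0" "T3 = cells m (\<lambda>_. 1)" "h3 = int m"
| load: "run_inv w t (1, [(T0, h0), (T1, h1), (T2, h2), (T3, h3)])"
  if "t \<le> n + 1 + i" "size_prefix w n" "i \<le> n" "n + 1 + i \<le> length w"
    "T0 = input_from w (n + 1 + i)" "h0 = int (n + 1 + i)" "T1 = cells n (\<lambda>_. 1)" "h1 = int n"
    "T2 = cells i (col_sym w n {})" "h2 = int i" "T3 = cells n (\<lambda>_. 1)" "h3 = int n - 1 - int i"
| copy: "run_inv w t (2, [(T0, h0), (T1, h1), (T2, h2), (T3, h3)])"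
  if "t \<le> Suc s * period (length w) + (n - i)" "ready w n s" "i \<le> n"
    "T0 = input_from w (2 * n + 1)" "h0 = int (2 * n + 1)" "T1 = cells n f" "h1 = int i - 1"
    "\<And>k. k < n \<Longrightarrow> f k \<noteq> 0" "\<And>k. i \<le> k \<Longrightarrow> k < n \<Longrightarrow> f k = row_sym (level w n s) k"
    "T2 = cells n (col_sym w n (level w n s))" "h2 = int i - 1"
    "T3 = cells n (\<lambda>_. 1)" "h3 = 2 * int s - 1"
| test: "run_inv w t (3, [(T0, h0), (T1, h1), (T2, h2), (T3, h3)])"
  if "t \<le> Suc s * period (length w) + n + 1" "ready w n s"
    "T0 = input_from w (2 * n + 1)" "h0 = int (2 * n + 1)"
    "T1 = cells n (row_sym (level w n s))" "h1 = 0"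
    "T2 = cells n (col_sym w n (level w n s))" "h2 = 0"
    "T3 = cells n (\<lambda>_. 1)" "h3 = int (2 * s)"
| sweep: "run_inv w t (4, [(T0, h0), (T1, h1), (T2, h2), (T3, h3)])"
  if "t \<le> Suc s * period (length w) + n + 2 + i * (2 * n + 4) + j" "ready w n s" "2 * s < n"
    "i < n" "j \<le> n" "2 * n + 1 + i * n + j \<le> length w" "\<And>y. y \<in> seen w n s i j \<Longrightarrow> \<not> source w n y"
    "T0 = input_from w (2 * n + 1)" "h0 = int (2 * n + 1 + i * n + j)"
    "T1 = cells n (row_sym (level w n s))" "h1 = int i"
    "T2 = cells n (col_sym w n (level w n s \<union> seen w n s i j))" "h2 = int j"
    "T3 = cells n (\<lambda>_. 1)" "h3 = int (2 * s)"
| row_end: "run_inv w t (5, [(T0, h0), (T1, h1), (T2, h2), (T3, h3)])"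
  if "t \<le> Suc s * period (length w) + n + 2 + i * (2 * n + 4) + n + 1" "ready w n s" "2 * s < n"
    "i < n" "2 * n + 1 + Suc i * n \<le> length w" "\<And>y. y \<in> seen w n s (Suc i) 0 \<Longrightarrow> \<not> source w n y"
    "T0 = input_from w (2 * n + 1)" "h0 = int (2 * n + 1 + Suc i * n)"
    "T1 = cells n (row_sym (level w n s))" "h1 = int (Suc i)"
    "T2 = cells n (col_sym w n (level w n s \<union> seen w n s (Suc i) 0))" "h2 = int n"
    "T3 = cells n (\<lambda>_. 1)" "h3 = int (2 * s)"
| row_rewind: "run_inv w t (6, [(T0, h0), (T1, h1), (T2, h2), (T3, h3)])"
  if "t \<le> Suc s * period (length w) + n + 2 + i * (2 * n + 4) + n + 2 + (n - k)"
    "ready w n s" "2 * s < n"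
    "Suc i < n" "k \<le> n" "2 * n + 1 + Suc i * n \<le> length w"
    "\<And>y. y \<in> seen w n s (Suc i) 0 \<Longrightarrow> \<not> source w n y"
    "T0 = input_from w (2 * n + 1)" "h0 = int (2 * n + 1 + Suc i * n)"
    "T1 = cells n (row_sym (level w n s))" "h1 = int (Suc i)"
    "T2 = cells n (col_sym w n (level w n s \<union> seen w n s (Suc i) 0))" "h2 = int k - 1"
    "T3 = cells n (\<lambda>_. 1)" "h3 = int (2 * s)"
| rewind: "run_inv w t (7, [(T0, h0), (T1, h1), (T2, h2), (T3, h3)])"
  if "t \<le> Suc s * period (length w) + n + 2 + n * (2 * n + 4) + (length w - k)"
    "ready w n (Suc s)" "2 * n + 1 \<le> k" "k \<le> length w"
    "T0 = input_from w (2 * n + 1)" "h0 = int k - 1"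
    "T1 = cells n (row_sym (level w n s))" "h1 = int n"
    "T2 = cells n (col_sym w n (level w n (Suc s)))" "h2 = int n"
    "T3 = cells n (\<lambda>_. 1)" "h3 = int (2 * s)"
| accepted: "good w \<Longrightarrow> run_inv w t (8, ts)"
| rejected: "\<not> good w \<Longrightarrow> run_inv w t (9, ts)"

lemma run_inv_size_step:
  assumes "t \<le> m" "m \<le> length w" "\<forall>k < m. \<not> w ! k"
    "T0 = input_from w m" "h0 = int m" "T1 = cells m (\<lambda>_. 1)" "h1 = int m"
    "T2 = (\<lambda>_. 0)" "h2 = 0" "T3 = cells m (\<lambda>_. 1)" "h3 = int m"
  shows "run_inv w (Suc t) (step machine (0, [(T0, h0), (T1, h1), (T2, h2), (T3, h3)]))"
proof -
  consider "m = length w" | "m < length w" "w ! m" | "m < length w" "\<not> w ! m"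
    using assms(2) by linarith
  then show ?thesis
  proof cases
    case 1
    then have r: "T0 h0 = 0" using assms by simp
    have "\<not> good w" using assms 1 by (auto simp: good_def size_prefix_def)
    then show ?thesis by (simp add: step_simps r rejected)
  next
    case 2
    then have r: "T0 h0 = 2" using assms by simp
    have eq: "step machine (0, [(T0, h0), (T1, h1), (T2, h2), (T3, h3)]) =
      (1, [(T0(h0 := 0), h0 + 1), (T1, h1), (T2, h2), (T3, h3 - 1)])"
      by (simp add: step_simps r)
    show ?thesis unfolding eq
      by (rule load[where n = m and i = 0])
        (use assms 2 in \<open>auto simp: size_prefix_def input_from_Suc cells_def\<close>)
  next
    case 3
    then have r: "T0 h0 = 1" using assms by simp
    have eq: "step machine (0, [(T0, h0), (T1, h1), (T2, h2), (T3, h3)]) =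
      (0, [(T0(h0 := 0), h0 + 1), (T1(h1 := 1), h1 + 1), (T2, h2), (T3(h3 := 1), h3 + 1)])"
      by (simp add: step_simps r)
    show ?thesis unfolding eq
      by (rule size[where m = "Suc m"])
        (use assms 3 in \<open>auto simp: less_Suc_eq input_from_Suc cells_Suc\<close>)
  qed
qed

text \<open>The counter doubles as a loop variable: its head walks back over the \<open>n\<close>
  marks while \<open>n\<close> letters are read, and the blank at -1 ends the phase.\<close>

lemma run_inv_load_step:
  assumes "t \<le> n + 1 + i" "size_prefix w n" "i \<le> n" "n + 1 + i \<le> length w"
    "T0 = input_from w (n + 1 + i)" "h0 = int (n + 1 + i)" "T1 = cells n (\<lambda>_. 1)" "h1 = int n"
    "T2 = cells i (col_sym w n {})" "h2 = int i" "T3 = cells n (\<lambda>_. 1)" "h3 = int n - 1 - int i"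
  shows "run_inv w (Suc t) (step machine (1, [(T0, h0), (T1, h1), (T2, h2), (T3, h3)]))"
proof -
  consider "i = n" | "i < n" "n + 1 + i < length w" | "i < n" "n + 1 + i = length w"
    using assms(3,4) by linarith
  then show ?thesis
  proof cases
    case 1
    then have r: "T3 h3 = 0" using assms by simp
    have eq: "step machine (1, [(T0, h0), (T1, h1), (T2, h2), (T3, h3)]) =
      (2, [(T0, h0), (T1, h1 - 1), (T2, h2 - 1), (T3, h3)])"
      by (simp add: step_simps r)
    have "Suc t \<le> 2 * n + 2" "n \<le> length w" using assms 1 by auto
    then have "Suc t \<le> Suc 0 * period (length w)" unfolding period_def by simp
    moreover have "T2 = cells n (col_sym w n (level w n 0))"
      unfolding assms(9) 1 by (rule cells_cong) (auto simp: col_sym_def)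
    moreover have "T0 = input_from w (2 * n + 1)" using assms(5) 1 by (simp add: mult_2)
    ultimately show ?thesis unfolding eq
      by (intro copy[where n = n and i = n and s = 0 and f = "\<lambda>_. 1"])
        (use assms(1-4,6-12) 1 in \<open>simp_all add: ready_def\<close>)
  next
    case 2
    then have r: "T3 h3 = 1" "T0 h0 = (if source w n i then 2 else 1)"
      unfolding assms(5,6,11,12) input_from_at by (auto simp: cells_def source_def)
    have eq: "step machine (1, [(T0, h0), (T1, h1), (T2, h2), (T3, h3)]) =
      (1, [(T0(h0 := 0), h0 + 1), (T1, h1), (T2(h2 := col_sym w n {} i), h2 + 1), (T3, h3 - 1)])"
      by (simp add: step_simps r col_sym_def)
    show ?thesis unfolding eq
      by (rule load[where n = n and i = "Suc i"])
        (use assms 2 input_from_Suc[of w "n + 1 + i"] in \<open>auto simp: cells_Suc\<close>)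
  next
    case 3
    then have r: "T3 h3 = 1" "T0 h0 = 0"
      unfolding assms(5,6,11,12) input_from_at by (auto simp: cells_def)
    have "\<not> good w" using 3 by (simp add: good_iff[OF assms(2)])
    then show ?thesis by (simp add: step_simps r rejected)
  qed
qed

text \<open>New marks stay on the column tape until they are copied, so one sweep lengthens walks by
  exactly one edge. Old row symbols are only tested for being blank, so stale ones do no
  harm.\<close>

lemma run_inv_copy_step:
  assumes "t \<le> Suc s * period (length w) + (n - i)" "ready w n s" "i \<le> n"
    "T0 = input_from w (2 * n + 1)" "h0 = int (2 * n + 1)" "T1 = cells n f" "h1 = int i - 1"
    "\<And>k. k < n \<Longrightarrow> f k \<noteq> 0" "\<And>k. i \<le> k \<Longrightarrow> k < n \<Longrightarrow> f k = row_sym (level w n s) k"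
    "T2 = cells n (col_sym w n (level w n s))" "h2 = int i - 1"
    "T3 = cells n (\<lambda>_. 1)" "h3 = 2 * int s - 1"
  shows "run_inv w (Suc t) (step machine (2, [(T0, h0), (T1, h1), (T2, h2), (T3, h3)]))"
proof (cases i)
  case 0
  from 0 have r: "T1 h1 = 0" using assms by simp
  have eq: "step machine (2, [(T0, h0), (T1, h1), (T2, h2), (T3, h3)]) =
    (3, [(T0, h0), (T1, h1 + 1), (T2, h2 + 1), (T3, h3 + 1)])"
    by (simp add: step_simps r)
  have "T1 = cells n (row_sym (level w n s))"
    unfolding assms(6) using assms(9) 0 by (intro cells_cong) simp
  then show ?thesis unfolding eq
    by (intro test[where n = n and s = s]) (use assms 0 in auto)
next
  case (Suc j)
  have j: "j < n" "h1 = int j" "h2 = int j" using assms(3,7,11) Suc by auto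
  have "T2 h2 = 1 \<longleftrightarrow> j \<notin> level w n s"
    using j by (simp add: assms(10) col_sym_def source_in_level)
  moreover have "T1 h1 \<noteq> 0" using j assms(8) by (simp add: assms(6))
  ultimately have eq: "step machine (2, [(T0, h0), (T1, h1), (T2, h2), (T3, h3)]) =
    (2, [(T0, h0), (T1(h1 := row_sym (level w n s) j), h1 - 1), (T2, h2 - 1), (T3, h3)])"
    by (simp add: step_simps row_sym_def)
  show ?thesis unfolding eq
    by (rule copy[where n = n and s = s and i = j and f = "f(j := row_sym (level w n s) j)"])
      (use assms j Suc in \<open>auto simp: cells_upd row_sym_def\<close>)
qed

lemma run_inv_test_step:
  assumes "t \<le> Suc s * period (length w) + n + 1" "ready w n s"
    "T0 = input_from w (2 * n + 1)" "h0 = int (2 * n + 1)"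
    "T1 = cells n (row_sym (level w n s))" "h1 = 0"
    "T2 = cells n (col_sym w n (level w n s))" "h2 = 0"
    "T3 = cells n (\<lambda>_. 1)" "h3 = int (2 * s)"
  shows "run_inv w (Suc t) (step machine (3, [(T0, h0), (T1, h1), (T2, h2), (T3, h3)]))"
proof -
  have prefix: "size_prefix w n" using assms(2) by (simp add: ready_def)
  consider "n = 0" | "0 < n" "n \<le> 2 * s" | "2 * s < n" by linarith
  \<comment> \<open>For \<open>n = 0\<close> the counter is exhausted as well, so the empty universe
    must be rejected first.\<close>
  then show ?thesis
  proof cases
    case 1
    then have r: "T1 h1 = 0" using assms by (simp add: cells_def)
    have "\<not> good w" using 1 by (simp add: good_iff[OF prefix])
    then show ?thesis by (simp add: step_simps r rejected)
  next
    case 2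
    then have r: "T1 h1 \<noteq> 0" "T3 h3 = 0" using assms by (auto simp: cells_def row_sym_def)
    \<comment> \<open>Here \<open>s > 0\<close>, so \<open>ready\<close> supplies the length, and
      every \<open>r\<close> with 2 * r < n lies below \<open>s\<close>.\<close>
    have "good w"
      using 2 assms(2) unfolding good_iff[OF prefix] ready_def by auto
    with r show ?thesis by (simp add: step_simps accepted)
  next
    case 3
    then have r: "T1 h1 \<noteq> 0" "T3 h3 = 1" using assms by (auto simp: cells_def row_sym_def)
    then have eq: "step machine (3, [(T0, h0), (T1, h1), (T2, h2), (T3, h3)]) =
      (4, [(T0, h0), (T1, h1), (T2, h2), (T3, h3)])"
      by (simp add: step_simps)
    show ?thesis unfolding eq
      by (rule sweep[where n = n and s = s and i = 0 and j = 0])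
        (use assms 3 in \<open>auto simp: seen_0 ready_def\<close>)
  qed
qed

lemma run_inv_sweep_step:
  assumes "t \<le> Suc s * period (length w) + n + 2 + i * (2 * n + 4) + j" "ready w n s" "2 * s < n"
    "i < n" "j \<le> n" "2 * n + 1 + i * n + j \<le> length w" "\<And>y. y \<in> seen w n s i j \<Longrightarrow> \<not> source w n y"
    "T0 = input_from w (2 * n + 1)" "h0 = int (2 * n + 1 + i * n + j)"
    "T1 = cells n (row_sym (level w n s))" "h1 = int i"
    "T2 = cells n (col_sym w n (level w n s \<union> seen w n s i j))" "h2 = int j"
    "T3 = cells n (\<lambda>_. 1)" "h3 = int (2 * s)"
  shows "run_inv w (Suc t) (step machine (4, [(T0, h0), (T1, h1), (T2, h2), (T3, h3)]))"
proof -
  have prefix: "size_prefix w n" using assms(2) by (simp add: ready_def)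
  consider "j = n" | "j < n" "2 * n + 1 + i * n + j = length w"
    | "j < n" "2 * n + 1 + i * n + j < length w"
    using assms(5,6) by linarith
  then show ?thesis
  proof cases
    case 1
    then have r: "T2 h2 = 0" using assms by simp
    have eq: "step machine (4, [(T0, h0), (T1, h1), (T2, h2), (T3, h3)]) =
      (5, [(T0, h0), (T1, h1 + 1), (T2, h2), (T3, h3)])"
      by (simp add: step_simps r)
    show ?thesis unfolding eq
      by (rule row_end[where n = n and s = s and i = i])
        (use assms 1 in \<open>auto simp: seen_Suc_row\<close>)
  next
    case 2
    then have r: "T2 h2 \<noteq> 0" "T0 h0 = 0"
      unfolding assms(8,9,12,13) input_from_at cells_at by (auto simp: col_sym_def)
    \<comment> \<open>The input ended inside row \<open>i\<close>, so it is shorter than a full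
      matrix requires.\<close>
    have "Suc i * n \<le> n * n" using assms(4) by (intro mult_right_mono) auto
    then have "\<not> good w" using 2 by (simp add: good_iff[OF prefix])
    with r show ?thesis by (simp add: step_simps rejected)
  next
    case 3
    let ?X = "level w n s \<union> seen w n s i j"
    have r: "T0 h0 = (if edge w n i j then 2 else 1)" "T1 h1 = row_sym (level w n s) i"
      "T2 h2 = col_sym w n ?X j"
      unfolding assms(8-13) input_from_at cells_at using 3 assms(4) by (auto simp: edge_def)
    show ?thesis
    proof (cases "edge w n i j \<and> i \<in> level w n s")
      case step: True
      show ?thesis
      proof (cases "source w n j")
        case True
        have "hit w n s" using step True 3 by (auto simp: hit_def)
        then have "\<not> good w" using assms(3) by (auto simp: good_iff[OF prefix])
        with step True show ?thesis by (simp add: step_simps r row_sym_def col_sym_def rejected)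
      next
        case False
        have eq: "step machine (4, [(T0, h0), (T1, h1), (T2, h2), (T3, h3)]) =
          (4, [(T0, h0 + 1), (T1, h1), (T2(h2 := 2), h2 + 1), (T3, h3)])"
          using step False by (simp add: step_simps r row_sym_def col_sym_def)
        have "T2(h2 := 2) = cells n (col_sym w n (level w n s \<union> seen w n s i (Suc j)))"
          unfolding assms(12,13) cells_upd[OF 3(1)]
          by (rule cells_cong) (use step False 3 in \<open>auto simp: col_sym_def seen_Suc_col\<close>)
        then show ?thesis unfolding eq
          by (intro sweep[where n = n and s = s and i = i and j = "Suc j"])
            (use assms 3 step False in \<open>auto simp: seen_Suc_col split: if_splits\<close>)
      qed
    next
      case False
      then have eq: "step machine (4, [(T0, h0), (T1, h1), (T2, h2), (T3, h3)]) =
        (4, [(T0, h0 + 1), (T1, h1), (T2, h2 + 1), (T3, h3)])"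
        by (auto simp: step_simps r row_sym_def col_sym_def)
      have "seen w n s i (Suc j) = seen w n s i j"
        using False 3 by (auto simp: seen_Suc_col)
      then show ?thesis unfolding eq
        by (intro sweep[where n = n and s = s and i = i and j = "Suc j"])
          (use assms 3 in auto)
    qed
  qed
qed

text \<open>A blank on the row tape says that all \<open>n\<close> rows are done; the input is then
  well-formed iff it ends at the same moment.\<close>

lemma run_inv_row_end_step:
  assumes "t \<le> Suc s * period (length w) + n + 2 + i * (2 * n + 4) + n + 1" "ready w n s" "2 * s < n"
    "i < n" "2 * n + 1 + Suc i * n \<le> length w" "\<And>y. y \<in> seen w n s (Suc i) 0 \<Longrightarrow> \<not> source w n y"
    "T0 = input_from w (2 * n + 1)" "h0 = int (2 * n + 1 + Suc i * n)"
    "T1 = cells n (row_sym (level w n s))" "h1 = int (Suc i)"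
    "T2 = cells n (col_sym w n (level w n s \<union> seen w n s (Suc i) 0))" "h2 = int n"
    "T3 = cells n (\<lambda>_. 1)" "h3 = int (2 * s)"
  shows "run_inv w (Suc t) (step machine (5, [(T0, h0), (T1, h1), (T2, h2), (T3, h3)]))"
proof -
  have prefix: "size_prefix w n" using assms(2) by (simp add: ready_def)
  consider "Suc i < n" | "Suc i = n" "2 * n + 1 + n * n = length w"
    | "Suc i = n" "2 * n + 1 + n * n < length w"
    using assms(4,5) by (metis Suc_lessI le_neq_implies_less)
  then show ?thesis
  proof cases
    case 1
    then have r: "T1 h1 \<noteq> 0" unfolding assms(9,10) cells_at by (simp add: row_sym_def)
    then have eq: "step machine (5, [(T0, h0), (T1, h1), (T2, h2), (T3, h3)]) =
      (6, [(T0, h0), (T1, h1), (T2, h2 - 1), (T3, h3)])"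
      by (simp add: step_simps)
    show ?thesis unfolding eq
      by (rule row_rewind[where n = n and s = s and i = i and k = n]) (use assms 1 in auto)
  next
    case 2
    then have r: "T1 h1 = 0" "T0 h0 = 0"
      unfolding assms(7-10) input_from_at cells_at by simp_all
    have eq: "step machine (5, [(T0, h0), (T1, h1), (T2, h2), (T3, h3)]) =
      (7, [(T0, h0 - 1), (T1, h1), (T2, h2), (T3, h3)])"
      by (simp add: step_simps r)
    have "i * (2 * n + 4) + n + 2 \<le> n * (2 * n + 4)" using 2 by auto
    \<comment> \<open>After the last row \<open>seen\<close> comprises all successors of the level,
      so the absence of sources among them is the absence of a hit.\<close>
    moreover have "ready w n (Suc s)"
      using assms(2,3,6) 2 by (auto simp: ready_def hit_def less_Suc_eq seen_all)
    moreover have "level w n (Suc s) = level w n s \<union> seen w n s (Suc i) 0"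
      using 2 by (simp add: seen_all)
    moreover have "h0 = int (length w)" using assms(8) by (simp only: 2)
    ultimately show ?thesis unfolding eq
      by (intro rewind[where n = n and s = s and k = "length w"])
        (use assms(1-7,9-14) 2 in \<open>auto simp: algebra_simps\<close>)
  next
    case 3
    then have r: "T1 h1 = 0" "T0 h0 \<noteq> 0"
      unfolding assms(7-10) input_from_at cells_at by simp_all
    have "\<not> good w" using 3 by (simp add: good_iff[OF prefix])
    with r show ?thesis by (simp add: step_simps rejected)
  qed
qed

lemma run_inv_row_rewind_step:
  assumes "t \<le> Suc s * period (length w) + n + 2 + i * (2 * n + 4) + n + 2 + (n - k)"
    "ready w n s" "2 * s < n"
    "Suc i < n" "k \<le> n" "2 * n + 1 + Suc i * n \<le> length w"
    "\<And>y. y \<in> seen w n s (Suc i) 0 \<Longrightarrow> \<not> source w n y"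
    "T0 = input_from w (2 * n + 1)" "h0 = int (2 * n + 1 + Suc i * n)"
    "T1 = cells n (row_sym (level w n s))" "h1 = int (Suc i)"
    "T2 = cells n (col_sym w n (level w n s \<union> seen w n s (Suc i) 0))" "h2 = int k - 1"
    "T3 = cells n (\<lambda>_. 1)" "h3 = int (2 * s)"
  shows "run_inv w (Suc t) (step machine (6, [(T0, h0), (T1, h1), (T2, h2), (T3, h3)]))"
proof (cases k)
  case 0
  from 0 have r: "T2 h2 = 0" using assms by simp
  have eq: "step machine (6, [(T0, h0), (T1, h1), (T2, h2), (T3, h3)]) =
    (4, [(T0, h0), (T1, h1), (T2, h2 + 1), (T3, h3)])"
    by (simp add: step_simps r)
  show ?thesis unfolding eq
    by (rule sweep[where n = n and s = s and i = "Suc i" and j = 0]) (use assms 0 in auto)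
next
  case (Suc j)
  from Suc have "h2 = int j" "j < n" using assms(5,13) by auto
  then have r: "T2 h2 \<noteq> 0" using assms(12) by (simp add: col_sym_def)
  have eq: "step machine (6, [(T0, h0), (T1, h1), (T2, h2), (T3, h3)]) =
    (6, [(T0, h0), (T1, h1), (T2, h2 - 1), (T3, h3)])"
    using r by (simp add: step_simps)
  show ?thesis unfolding eq
    by (rule row_rewind[where n = n and s = s and i = i and k = j]) (use assms Suc in auto)
qed

lemma run_inv_rewind_step:
  assumes "t \<le> Suc s * period (length w) + n + 2 + n * (2 * n + 4) + (length w - k)"
    "ready w n (Suc s)" "2 * n + 1 \<le> k" "k \<le> length w"
    "T0 = input_from w (2 * n + 1)" "h0 = int k - 1"
    "T1 = cells n (row_sym (level w n s))" "h1 = int n"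
    "T2 = cells n (col_sym w n (level w n (Suc s)))" "h2 = int n"
    "T3 = cells n (\<lambda>_. 1)" "h3 = int (2 * s)"
  shows "run_inv w (Suc t) (step machine (7, [(T0, h0), (T1, h1), (T2, h2), (T3, h3)]))"
proof (cases "k = 2 * n + 1")
  case True
  \<comment> \<open>The erased prefix provides the blank that stops the rewind.\<close>
  have r: "T0 h0 = 0" using True assms(5,6) by (simp add: input_from_def)
  have eq: "step machine (7, [(T0, h0), (T1, h1), (T2, h2), (T3, h3)]) =
    (2, [(T0, h0 + 1), (T1, h1 - 1), (T2, h2 - 1), (T3, h3 + 1)])"
    by (simp add: step_simps r)
  have "n \<le> length w" using assms(3,4) by simp
  then have "n * n \<le> length w * length w" by (rule mult_le_mono) fact
  \<comment> \<open>The cost of a whole round: copying, \<open>n\<close> rows with their rewinds,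
    and rewinding the input. This is what \<open>period\<close> was chosen to dominate.\<close>
  then have "n + 3 + n * (2 * n + 4) + length w \<le> period (length w)"
    using \<open>n \<le> length w\<close> by (simp add: period_def algebra_simps)
  then have "Suc t \<le> Suc (Suc s) * period (length w)"
    using assms(1) by simp
  then show ?thesis unfolding eq
    by (intro copy[where n = n and s = "Suc s" and i = n and f = "row_sym (level w n s)"])
      (use assms True in \<open>auto simp: row_sym_def\<close>)
next
  case False
  then obtain j where j: "k = Suc j" "2 * n + 1 \<le> j" using assms(3) by (cases k) auto
  then have "T0 h0 \<noteq> 0" using assms(4-6) by simp
  then have eq: "step machine (7, [(T0, h0), (T1, h1), (T2, h2), (T3, h3)]) =
    (7, [(T0, h0 - 1), (T1, h1), (T2, h2), (T3, h3)])"
    by (simp add: step_simps)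
  show ?thesis unfolding eq
    by (rule rewind[where n = n and s = s and k = j]) (use assms j in auto)
qed

lemma run_inv_step:
  assumes "run_inv w t c"
  shows "run_inv w (Suc t) (step machine c)"
  using assms
proof cases
  case (accepted ts)
  then show ?thesis by (auto simp: step_def halted_def machine_def intro: run_inv.accepted)
next
  case (rejected ts)
  then show ?thesis by (auto simp: step_def halted_def machine_def intro: run_inv.rejected)
next
  case size
  show ?thesis unfolding size(1) by (rule run_inv_size_step) (fact size)+
next
  case load
  show ?thesis unfolding load(1) by (rule run_inv_load_step) (fact load)+
next
  case copy
  show ?thesis unfolding copy(1) by (rule run_inv_copy_step) (fact copy)+
next
  case test
  show ?thesis unfolding test(1) by (rule run_inv_test_step) (fact test)+
next
  case sweep
  show ?thesis unfolding sweep(1) by (rule run_inv_sweep_step) (fact sweep)+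
next
  case row_end
  show ?thesis unfolding row_end(1) by (rule run_inv_row_end_step) (fact row_end)+
next
  case row_rewind
  show ?thesis unfolding row_rewind(1) by (rule run_inv_row_rewind_step) (fact row_rewind)+
next
  case rewind
  show ?thesis unfolding rewind(1) by (rule run_inv_rewind_step) (fact rewind)+
qed

section \<open>Halting time and correctness of the machine\<close>

lemma run_inv_init: "run_inv w 0 (init machine w)"
proof -
  have "init machine w =
    (0, [(input_from w 0, 0), (cells 0 (\<lambda>_. 1), 0), (\<lambda>_. 0, 0), (cells 0 (\<lambda>_. 1), 0)])"
    by (simp add: init_def machine_def input_tape_def input_from_def cells_def numeral_eq_Suc fun_eq_iff)
  moreover have "run_inv w 0 \<dots>"
    by (rule size[where m = 0]) auto
  ultimately show ?thesis by simp
qed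

lemma run_inv_funpow: "run_inv w t ((step machine ^^ t) (init machine w))"
  by (induction t) (simp_all add: run_inv_init run_inv_step)

text \<open>A running machine is less than one period beyond \<open>Suc s\<close> periods, and
  \<open>s\<close> is at most the input length because the preceding round passed the test against
  \<open>n\<close>.\<close>

lemma run_inv_running_time:
  assumes "run_inv w t c" and "\<not> halted machine c"
  shows "t < (length w + 2) * period (length w)"
proof -
  have bound: ?thesis
    if "ready w n s" "t \<le> Suc s * period (length w) + a" "a < period (length w)" for n s a
  proof -
    have "s \<le> length w"
    proof (cases s)
      case (Suc r)
      then have "2 * r < n" "n < length w"
        using that(1) by (auto simp: ready_def size_prefix_def)
      then show ?thesis using Suc by simp
    qed simp
    then have "s * period (length w) \<le> length w * period (length w)"
      by (rule mult_right_mono) simp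
    with that(2,3) show ?thesis unfolding mult_Suc add_mult_distrib by linarith
  qed
  have small: "m \<le> 2 * length w \<Longrightarrow> m < (length w + 2) * period (length w)" for m
    by (simp add: period_def algebra_simps)
  have offset: "n + 2 + m + length w < period (length w)"
    if "ready w n s" "m \<le> n * (2 * n + 4)" for n s m
  proof -
    have "n \<le> length w" using that(1) by (simp add: ready_def)
    moreover from this have "n * (2 * n + 4) \<le> length w * (2 * length w + 4)"
      by (intro mult_le_mono) auto
    ultimately show ?thesis using that(2) by (simp add: period_def algebra_simps)
  qed
  have row: "i * (2 * n + 4) + (2 * n + 4) \<le> n * (2 * n + 4)" if "i < n" for i n :: nat
  proof -
    have "Suc i * (2 * n + 4) \<le> n * (2 * n + 4)" using that by (intro mult_right_mono) auto
    then show ?thesis by simp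
  qed
  from assms(1) show ?thesis
  proof cases
    case (size m)
    then show ?thesis using small[of m] by simp
  next
    case (load n i)
    then show ?thesis using small[of "n + 1 + i"] by simp
  next
    case (copy s n i)
    show ?thesis
      by (rule bound[OF copy(3,2)]) (use offset[OF copy(3), of 0] in linarith)
  next
    case (test s n)
    have "t \<le> Suc s * period (length w) + (n + 1)" using test(2) by linarith
    then show ?thesis
      by (rule bound[OF test(3)]) (use offset[OF test(3), of 0] in linarith)
  next
    case (sweep s n i j)
    have "t \<le> Suc s * period (length w) + (n + 2 + (i * (2 * n + 4) + j))"
      using sweep(2) by linarith
    then show ?thesis
      by (rule bound[OF sweep(3)])
        (use offset[OF sweep(3), of "i * (2 * n + 4) + j"] row[of i n] sweep in linarith)
  next
    case (row_end s n i)
    have "t \<le> Suc s * period (length w) + (n + 2 + (i * (2 * n + 4) + n + 1))"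
      using row_end(2) by linarith
    then show ?thesis
      by (rule bound[OF row_end(3)])
        (use offset[OF row_end(3), of "i * (2 * n + 4) + n + 1"] row[of i n] row_end in linarith)
  next
    case (row_rewind s n i k)
    have "t \<le> Suc s * period (length w) + (n + 2 + (i * (2 * n + 4) + n + 2 + (n - k)))"
      using row_rewind(2) by linarith
    then show ?thesis
      by (rule bound[OF row_rewind(3)])
        (use offset[OF row_rewind(3), of "i * (2 * n + 4) + n + 2 + (n - k)"] row[of i n]
           row_rewind in linarith)
  next
    case (rewind s n k)
    have "ready w n s" using rewind by (auto simp: ready_def)
    moreover have "t \<le> Suc s * period (length w) + (n + 2 + n * (2 * n + 4) + (length w - k))"
      using rewind(2) by linarith
    ultimately show ?thesis
      by (rule bound) (use offset[OF \<open>ready w n s\<close>, of "n * (2 * n + 4)"] in linarith)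
  qed (use assms(2) in \<open>auto simp: halted_def machine_def\<close>)
qed

lemma run_inv_halted:
  assumes "run_inv w t c" and "halted machine c"
  shows "fst c = accept machine \<longleftrightarrow> good w"
  using assms(1) by cases (use assms(2) in \<open>auto simp: halted_def machine_def\<close>)

lemma ptime_good: "ptime {w. good w}"
proof -
  define p :: "nat poly" where "p = [:2, 1:] * [:10, 6, 2:]"
  have p: "poly p N = (N + 2) * period N" for N
    by (simp add: p_def period_def algebra_simps)
  have "let c = (step machine ^^ poly p (length w)) (init machine w)
    in halted machine c \<and> (fst c = accept machine \<longleftrightarrow> w \<in> {w. good w})" for w
  proof -
    define c where "c = (step machine ^^ poly p (length w)) (init machine w)"
    have run_inv: "run_inv w (poly p (length w)) c" unfolding c_def by (rule run_inv_funpow)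
    \<comment> \<open>A machine still running at this time would violate the strict bound.\<close>
    then have "halted machine c" using run_inv_running_time p by fastforce
    moreover from run_inv this have "fst c = accept machine \<longleftrightarrow> good w"
      by (rule run_inv_halted)
    ultimately show ?thesis by (simp add: c_def Let_def)
  qed
  then show ?thesis unfolding ptime_def using wf_machine by blast
qed

section \<open>Encodings\<close>

lemma nth_concat_map:
  assumes "\<And>x. x \<in> set xs \<Longrightarrow> length (f x) = n" and "i < length xs" and "j < n"
  shows "concat (map f xs) ! (i * n + j) = f (xs ! i) ! j"
  using assms
proof (induction xs arbitrary: i)
  case (Cons x xs)
  then show ?case by (cases i) (auto simp: nth_append)
qed simp

lemma encode_eq:
  "encode [1, 2] xs A = replicate (length xs) False @ True # map (\<lambda>x. [x] \<in> rel A 0) xs @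
     concat (map (\<lambda>x. map (\<lambda>y. [x, y] \<in> rel A 1) xs) xs)"
proof -
  have "concat (map (\<lambda>x. [[x]]) ys) = map (\<lambda>x. [x]) ys" for ys :: "'a list"
    by (induction ys) auto
  then show ?thesis
    unfolding encode_def by (simp add: numeral_2_eq_2 map_concat o_def)
qed

lemma
  fixes xs :: "'a list" and A
  defines "w \<equiv> encode [1, 2] xs A" and "n \<equiv> length xs"
  shows size_prefix_encode: "size_prefix w n"
    and length_encode: "length w = 2 * n + 1 + n * n"
    and source_encode: "i < n \<Longrightarrow> source w n i \<longleftrightarrow> [xs ! i] \<in> rel A 0"
    and edge_encode: "i < n \<Longrightarrow> j < n \<Longrightarrow> edge w n i j \<longleftrightarrow> [xs ! i, xs ! j] \<in> rel A 1"
proof -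
  let ?rows = "concat (map (\<lambda>x. map (\<lambda>y. [x, y] \<in> rel A 1) xs) xs)"
  let ?u = "replicate n False @ True # map (\<lambda>x. [x] \<in> rel A 0) xs"
  have w: "w = ?u @ ?rows"
    unfolding w_def n_def encode_eq by simp
  have u: "length ?u = 2 * n + 1" by (simp add: n_def)
  have rows: "length ?rows = n * n" by (simp add: length_concat o_def sum_list_triv n_def)
  show "size_prefix w n" by (simp add: w size_prefix_def nth_append)
  show "length w = 2 * n + 1 + n * n" using u rows unfolding w by (simp only: length_append)
  show "source w n i \<longleftrightarrow> [xs ! i] \<in> rel A 0" if "i < n"
    using that by (simp add: w source_def nth_append n_def)
  show "edge w n i j \<longleftrightarrow> [xs ! i, xs ! j] \<in> rel A 1" if "i < n" "j < n"
  proof -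
    have "w ! (2 * n + 1 + i * n + j) = ?rows ! (i * n + j)"
      unfolding w u[symmetric] by (simp add: nth_append add.assoc)
    also have "\<dots> \<longleftrightarrow> [xs ! i, xs ! j] \<in> rel A 1"
      using that by (subst nth_concat_map) (auto simp: n_def)
    finally show ?thesis unfolding edge_def .
  qed
qed

text \<open>Beyond the predicate bits, an offset \<open>l\<close> is the matrix entry in row
  \<open>l div n\<close>, column \<open>l mod n\<close>.\<close>

lemma word_eqI:
  assumes "size_prefix v n" and "size_prefix w n"
    and "length v = 2 * n + 1 + n * n" and "length w = 2 * n + 1 + n * n"
    and source: "\<And>i. i < n \<Longrightarrow> source v n i = source w n i"
    and edge: "\<And>i j. i < n \<Longrightarrow> j < n \<Longrightarrow> edge v n i j = edge w n i j"
  shows "v = w"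
proof (rule nth_equalityI)
  fix k assume k: "k < length v"
  consider "k < n" | "k = n" | "n < k" "k < 2 * n + 1" | "2 * n + 1 \<le> k" by linarith
  then show "v ! k = w ! k"
  proof cases
    case 3
    then show ?thesis using source[of "k - n - 1"] by (simp add: source_def)
  next
    case 4
    define l where "l = k - (2 * n + 1)"
    have l: "k = 2 * n + 1 + l" "l < n * n" using 4 k assms(3) by (auto simp: l_def)
    then have "0 < n" by (cases n) auto
    then have "l div n < n" "l mod n < n" using l(2) by (auto simp: less_mult_imp_div_less)
    from edge[OF this] show ?thesis
      unfolding edge_def l(1) by (simp add: add.assoc)
  qed (use assms(1,2) in \<open>auto simp: size_prefix_def\<close>)
qed (simp add: assms)

section \<open>Decoding words into structures\<close>

definition word_struct :: "bool list \<Rightarrow> nat \<Rightarrow> nat struct" where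
  "word_struct w n = \<lparr>univ = {..<n},
     rel = (\<lambda>_. {})(0 := {[i] | i. i < n \<and> source w n i},
       1 := {[i, j] | i j. i < n \<and> j < n \<and> edge w n i j})\<rparr>"

lemma word_struct_fin_structs: "0 < n \<Longrightarrow> word_struct w n \<in> fin_structs [1, 2]"
  unfolding fin_structs_iff by (auto simp: word_struct_def)

lemma encode_word_struct:
  assumes "size_prefix w n" and "length w = 2 * n + 1 + n * n"
  shows "encode [1, 2] [0..<n] (word_struct w n) = w"
proof (rule word_eqI[of _ n])
  let ?v = "encode [1, 2] [0..<n] (word_struct w n)"
  show "size_prefix ?v n" "length ?v = 2 * n + 1 + n * n"
    using size_prefix_encode[of "[0..<n]"] length_encode[of "[0..<n]"] by simp_all
  show "source ?v n i = source w n i" if "i < n" for i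
    using that source_encode[of i "[0..<n]"] by (simp add: word_struct_def)
  show "edge ?v n i j = edge w n i j" if "i < n" "j < n" for i j
    using that edge_encode[of i "[0..<n]" j] by (simp add: word_struct_def)
qed (use assms in auto)

lemma level_iff_walk:
  "y \<in> level w n s \<longleftrightarrow>
     (\<exists>r \<le> s. \<exists>x < n. source w n x \<and> (x, y) \<in> {(i, j). i < n \<and> j < n \<and> edge w n i j} ^^ r)"
    (is "_ \<longleftrightarrow> (\<exists>r \<le> s. \<exists>x < n. _ \<and> _ \<in> ?E ^^ r)")
proof (induction s arbitrary: y)
  case (Suc s)
  show ?case
  proof
    assume "y \<in> level w n (Suc s)"
    then consider "y \<in> level w n s" | z where "z \<in> level w n s" "y < n" "edge w n z y"
      by auto
    then show "\<exists>r \<le> Suc s. \<exists>x < n. source w n x \<and> (x, y) \<in> ?E ^^ r"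
    proof cases
      case 1
      then show ?thesis unfolding Suc.IH using le_SucI by blast
    next
      case (2 z)
      then obtain r x where "r \<le> s" "x < n" "source w n x" "(x, z) \<in> ?E ^^ r"
        unfolding Suc.IH by blast
      moreover from this have "(x, y) \<in> ?E ^^ Suc r"
        using 2 level_less[OF 2(1)] by auto
      ultimately show ?thesis by (meson Suc_le_mono)
    qed
  next
    assume "\<exists>r \<le> Suc s. \<exists>x < n. source w n x \<and> (x, y) \<in> ?E ^^ r"
    then obtain r x where r: "r \<le> Suc s" "x < n" "source w n x" "(x, y) \<in> ?E ^^ r" by blast
    show "y \<in> level w n (Suc s)"
    proof (cases r)
      case 0
      then show ?thesis using r source_in_level by auto
    next
      case (Suc r')
      then obtain z where "(x, z) \<in> ?E ^^ r'" "z < n" "y < n" "edge w n z y"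
        using r(4) by auto
      moreover from this have "z \<in> level w n s"
        unfolding Suc.IH using r Suc by auto
      ultimately show ?thesis by auto
    qed
  qed
qed auto

text \<open>\<open>hit\<close> at \<open>s\<close> covers all walks of length at most
  \<open>Suc s\<close>, while \<open>short\<close> fixes the length; the two agree under the
  existential quantifier because a smaller index also meets the bound.\<close>

lemma short_word_struct: "short (word_struct w n) \<longleftrightarrow> (\<exists>s. 2 * s < n \<and> hit w n s)"
proof -
  let ?E = "{(i, j). i < n \<and> j < n \<and> edge w n i j}"
  have E: "{(u, v). [u, v] \<in> rel (word_struct w n) 1} = ?E"
    by (auto simp: word_struct_def)
  have short: "short (word_struct w n) \<longleftrightarrow> (\<exists>s x y. 2 * s < n \<and> x < n \<and> source w n x \<and>
      y < n \<and> source w n y \<and> (x, y) \<in> ?E ^^ Suc s)"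
    unfolding short_def E by (simp add: word_struct_def del: relpow.simps)
  have hit: "hit w n s \<longleftrightarrow> (\<exists>r \<le> s. \<exists>x < n. source w n x \<and>
      (\<exists>y < n. source w n y \<and> (x, y) \<in> ?E ^^ Suc r))" for s
  proof
    assume "hit w n s"
    then obtain z y where z: "z \<in> level w n s" "y < n" "edge w n z y" "source w n y"
      by (auto simp: hit_def)
    then obtain r x where "r \<le> s" "x < n" "source w n x" "(x, z) \<in> ?E ^^ r"
      unfolding level_iff_walk by blast
    moreover from this have "(x, y) \<in> ?E ^^ Suc r"
      using z level_less[OF z(1)] by auto
    ultimately show "\<exists>r \<le> s. \<exists>x < n. source w n x \<and>
      (\<exists>y < n. source w n y \<and> (x, y) \<in> ?E ^^ Suc r)" using z by blast
  next
    assume "\<exists>r \<le> s. \<exists>x < n. source w n x \<and> (\<exists>y < n. source w n y \<and> (x, y) \<in> ?E ^^ Suc r)"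
    then obtain r x y where r: "r \<le> s" "x < n" "source w n x" "source w n y" "(x, y) \<in> ?E ^^ Suc r"
      by blast
    then obtain z where z: "(x, z) \<in> ?E ^^ r" "z < n" "y < n" "edge w n z y" by auto
    then have "z \<in> level w n s" unfolding level_iff_walk using r by blast
    with z r show "hit w n s" by (auto simp: hit_def)
  qed
  show ?thesis
    unfolding short hit by (meson le_refl le_less_trans mult_le_mono2)
qed

lemma good_word_struct:
  "good w \<longleftrightarrow> (\<exists>n > 0. size_prefix w n \<and> length w = 2 * n + 1 + n * n \<and>
     \<not> short (word_struct w n))"
  unfolding good_def short_word_struct by blast

lemma isomorphic_word_struct:
  assumes "A \<in> fin_structs [1, 2]" and "distinct xs" and "set xs = univ A"
  shows "isomorphic [1, 2] A (word_struct (encode [1, 2] xs A) (length xs))"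
proof -
  define f where "f = the_inv_into {..<length xs} ((!) xs)"
  have nth: "bij_betw ((!) xs) {..<length xs} (univ A)"
    using assms(2,3) by (simp add: bij_betw_nth)
  then have f: "bij_betw f (univ A) {..<length xs}"
    unfolding f_def by (rule bij_betw_the_inv_into)
  have f_less: "f a < length xs" if "a \<in> univ A" for a
    using f that by (auto simp: bij_betw_def)
  have nth_f: "xs ! f a = a" if "a \<in> univ A" for a
    unfolding f_def using nth that by (rule f_the_inv_into_f_bij_betw)
  define w where "w = encode [1, 2] xs A"
  have "source w (length xs) (f a) \<longleftrightarrow> [a] \<in> rel A 0" if "a \<in> univ A" for a
    unfolding w_def source_encode[OF f_less[OF that]] nth_f[OF that] ..
  moreover have "edge w (length xs) (f a) (f b) \<longleftrightarrow> [a, b] \<in> rel A 1"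
    if "a \<in> univ A" "b \<in> univ A" for a b
    unfolding w_def edge_encode[OF f_less[OF that(1)] f_less[OF that(2)]] that[THEN nth_f] ..
  ultimately show ?thesis
    unfolding isomorphic_iff w_def[symmetric]
    by (intro exI[of _ f] conjI ballI) (use f f_less in \<open>auto simp: word_struct_def\<close>)
qed

text \<open>The encodings of the class are exactly the good words: decoding an encoding gives an
  isomorphic copy, so closure under isomorphism applies, and conversely a good word encodes its own
  decoding.\<close>

lemma ptime_class_not_short:
  "ptime_class [1, 2] {A :: nat struct \<in> fin_structs [1, 2]. \<not> short A}"
proof -
  let ?C = "{A :: nat struct \<in> fin_structs [1, 2]. \<not> short A}"
  have "{encode [1, 2] xs A | xs A. A \<in> ?C \<and> distinct xs \<and> set xs = univ A} = {w. good w}"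
  proof (intro set_eqI iffI)
    fix w assume "w \<in> {encode [1, 2] xs A | xs A. A \<in> ?C \<and> distinct xs \<and> set xs = univ A}"
    then obtain xs A where A: "A \<in> ?C" "distinct xs" "set xs = univ A"
      and w: "w = encode [1, 2] xs A" by blast
    have "univ A \<noteq> {}" using A(1) by (simp add: fin_structs_def)
    then have pos: "0 < length xs" using A(3) by auto
    have "isomorphic [1, 2] A (word_struct w (length xs))"
      unfolding w using A by (intro isomorphic_word_struct) auto
    then have "word_struct w (length xs) \<in> ?C"
      using iso_closed_short A(1) word_struct_fin_structs[OF pos] unfolding iso_closed_def by blast
    then show "w \<in> {w. good w}"
      using pos size_prefix_encode[of xs A] length_encode[of xs A]
      unfolding good_word_struct w by blast
  next
    fix w assume "w \<in> {w. good w}"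
    then obtain n where n: "0 < n" "size_prefix w n" "length w = 2 * n + 1 + n * n"
      "\<not> short (word_struct w n)" unfolding good_word_struct by blast
    have "word_struct w n \<in> ?C" using n word_struct_fin_structs by blast
    moreover have "distinct [0..<n]" "set [0..<n] = univ (word_struct w n)"
      by (auto simp: word_struct_def)
    ultimately show "w \<in> {encode [1, 2] xs A | xs A. A \<in> ?C \<and> distinct xs \<and> set xs = univ A}"
      using encode_word_struct[OF n(2,3)] by (metis (mono_tags, lifting) mem_Collect_eq)
  qed
  then show ?thesis unfolding ptime_class_def using ptime_good by simp
qed

theorem theorem3:
  "\<exists>(\<tau> :: vocabulary) (C :: nat struct set).
     C \<subseteq> fin_structs \<tau> \<and> iso_closed \<tau> C \<and>
     ptime_class \<tau> C \<and> substructure_closed \<tau> C \<and>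
     \<not> (\<exists>\<phi>. lfp_sentence \<tau> \<phi> \<and> C = {A \<in> fin_structs \<tau>. models A \<phi>})"
proof (intro exI conjI)
  let ?C = "{A :: nat struct \<in> fin_structs [1, 2]. \<not> short A}"
  show "?C \<subseteq> fin_structs [1, 2]" by blast
  show "iso_closed [1, 2] ?C" by (rule iso_closed_short)
  show "ptime_class [1, 2] ?C" by (rule ptime_class_not_short)
  show "substructure_closed [1, 2] ?C" by (rule substructure_closed_short)
  show "\<not> (\<exists>\<phi>. lfp_sentence [1, 2] \<phi> \<and> ?C = {A \<in> fin_structs [1, 2]. models A \<phi>})"
    using short_not_definable by blast
qed

end
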